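(* Let $d,s,n\ge 1$ be integers, $\bar{s}:=\min(s,d)$, $V>0$ and $\sigma>0$. Let $\mathbf{x}^{(1)},\dots,\mathbf{x}^{(n)}$ be i.i.d. with density $p_0$ on $\mathbb{R}^d$ and $y_i=f^*(\mathbf{x}^{(i)})+\xi_i$, where $\xi_1,\dots,\xi_n$ are i.i.d. $N(0,\sigma^2)$ and independent of the covariates. Suppose that for some $M_1,\dots,M_d>0$ $$p_0(\mathbf{x})=0\ \text{ for }\mathbf{x}\notin\prod_{j=1}^d\Big[-\frac{M_j}{2},\frac{M_j}{2}\Big],\qquad B:=M_1\cdots M_d\cdot\sup_{\mathbf{x}}p_0(\mathbf{x})<\infty,$$ $$b:=M_1\cdots M_d\cdot\inf_{\mathbf{x}\in\prod_{j=1}^d[-M_j/2,M_j/2]}p_0(\mathbf{x})>0.$$ Let $$\mathfrak{M}^{d,s}_{n,V}:=\inf_{\hat{f}_n}\ \sup_{\substack{f^*\in\mathcal{F}^{d,s}_{\infty-\text{ST}}\\ V^{d,s}_{\infty-\text{XGB}}(f^* )\le V}}\mathbb{E}\|\hat{f}_n-f^*\|_{p_0,2}^2,$$ where the infimum is over all estimators $\hat{f}_n$ based on the data $(\mathbf{x}^{(1)},y_1),\dots,(\mathbf{x}^{(n)},y_n)$. Then there exist constants $C_{b,B,\bar{s}}>0$, depending only on $b$, $B$ and $\bar{s}$, and $C_{B,\bar{s}}>0$, depending only on $B$ and $\bar{s}$, such that $$\mathfrak{M}^{d,s}_{n,V}\ge C_{b,B,\bar{s}}\Big(\frac{\sigma^2V}{n}\Big)^{2/3}\bigg[\log\Big(\frac{nV^2}{\sigma^2}\Big)\bigg]^{2(\bar{s}-1)/3},$$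 provided that $n\ge C_{B,\bar{s}}(\sigma^2/V^2)$.
   Context: Notation: $[d]=\{1,\dots,d\}$ and $\|g\|_{p_0,2}^2=\int_{\mathbb{R}^d}g^2(\mathbf{x})p_0(\mathbf{x})\,d\mathbf{x}$. Function class. For (not necessarily disjoint) $L,U\subseteq[d]$ with $0<|L|+|U|\le s$ and threshold vectors $\mathbf{l}=(l_j,j\in L)$, $\mathbf{u}=(u_j,j\in U)$, let $b^{L,U}_{\mathbf{l},\mathbf{u}}(x_1,\dots,x_d)=\prod_{j\in L}\mathbf{1}(x_j\ge l_j)\cdot\prod_{j\in U}\mathbf{1}(x_j<u_j)$. For $c\in\mathbb{R}$ and finite signed Borel measures $\nu_{L,U}$ on $\mathbb{R}^{|L|+|U|}$, let $$f^{d,s}_{c,\{\nu_{L,U}\}}(\mathbf{x})=c+\sum_{0<|L|+|U|\le s}\int_{\mathbb{R}^{|L|+|U|}}b^{L,U}_{\mathbf{l},\mathbf{u}}(\mathbf{x})\,d\nu_{L,U}(\mathbf{l},\mathbf{u}).$$ $\mathcal{F}^{d,s}_{\infty-\text{ST}}$ is the set of all such functions, and for $f$ in it, $V^{d,s}_{\infty-\text{XGB}}(f)=\inf\{\sum_{0<|L|+|U|\le s}\|\nu_{L,U}\|_{\text{TV}}: f^{d,s}_{c,\{\nu_{L,U}\}}\equiv f\}$, with $\|\nu\|_{\text{TV}}=|\nu|(\mathbb{R}^{|L|+|U|})$. *)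

theory Defs
  imports "HOL-Probability.Probability"
begin

text \<open>
  The dimension varies inside the statement (the constants must not depend on it), so a point of
  d-dimensional space is an extensional function on \<open>{1..d}\<close>.
\<close>

definition Rd :: "nat \<Rightarrow> (nat \<Rightarrow> real) measure" where
  "Rd d = PiM {1..d} (\<lambda>_. lborel)"


subsection \<open>Finite signed measures\<close>

definition signed_measure :: "'a measure \<Rightarrow> ('a set \<Rightarrow> real) \<Rightarrow> bool" where
  "signed_measure M \<nu> \<longleftrightarrow>
     \<nu> {} = 0 \<and>
     (\<forall>A :: nat \<Rightarrow> 'a set. range A \<subseteq> sets M \<longrightarrow> disjoint_family A \<longrightarrow>
        (\<lambda>i. \<nu> (A i)) sums \<nu> (\<Union>i. A i))"

text \<open>
  The positive part of the Jordan decomposition, via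
  \<open>\<nu>\<^sup>+(A) = sup {\<nu>(B) | B \<subseteq> A measurable}\<close>. The truncation of negative numbers by \<open>ennreal\<close>
  is harmless, since \<open>B = {}\<close> is admissible. The negative part is the positive part of \<open>- \<nu>\<close>.
\<close>

definition upper_variation :: "'a measure \<Rightarrow> ('a set \<Rightarrow> real) \<Rightarrow> 'a measure" where
  "upper_variation M \<nu> =
     measure_of (space M) (sets M) (\<lambda>A. SUP B \<in> {B \<in> sets M. B \<subseteq> A}. ennreal (\<nu> B))"

definition lower_variation :: "'a measure \<Rightarrow> ('a set \<Rightarrow> real) \<Rightarrow> 'a measure" where
  "lower_variation M \<nu> = upper_variation M (\<lambda>A. - \<nu> A)"

definition tv_norm :: "'a measure \<Rightarrow> ('a set \<Rightarrow> real) \<Rightarrow> ennreal" where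
  "tv_norm M \<nu> =
     emeasure (upper_variation M \<nu>) (space M) + emeasure (lower_variation M \<nu>) (space M)"

definition signed_integral :: "'a measure \<Rightarrow> ('a set \<Rightarrow> real) \<Rightarrow> ('a \<Rightarrow> real) \<Rightarrow> real" where
  "signed_integral M \<nu> f =
     (\<integral>x. f x \<partial>upper_variation M \<nu>) - (\<integral>x. f x \<partial>lower_variation M \<nu>)"

text \<open>The set function above is countably additive, so \<open>measure_of\<close> is not vacuous.\<close>

lemma emeasure_upper_variation:
  assumes \<nu>: "signed_measure M \<nu>" and A: "A \<in> sets M"
  shows "emeasure (upper_variation M \<nu>) A = (SUP B \<in> {B \<in> sets M. B \<subseteq> A}. ennreal (\<nu> B))"
proof -
  define P where "P A = (SUP B \<in> {B \<in> sets M. B \<subseteq> A}. ennreal (\<nu> B))" for A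
  have zero: "\<nu> {} = 0"
    using \<nu> by (simp add: signed_measure_def)
  have sums: "(\<lambda>i. \<nu> (F i)) sums \<nu> (\<Union>i. F i)"
    if "range F \<subseteq> sets M" "disjoint_family F" for F :: "nat \<Rightarrow> 'a set"
    using \<nu> that by (simp add: signed_measure_def)
  have upper: "ennreal (\<nu> B) \<le> P A" if "B \<in> sets M" "B \<subseteq> A" for A B
    unfolding P_def using that by (intro SUP_upper) auto
  have add: "\<nu> (B \<union> C) = \<nu> B + \<nu> C" if "B \<in> sets M" "C \<in> sets M" "B \<inter> C = {}" for B C
  proof -
    have "(\<lambda>i. \<nu> (binaryset B C i)) sums \<nu> (\<Union>i. binaryset B C i)"
      using that by (intro sums) (auto simp: range_binaryset_eq disjoint_family_on_def binaryset_def)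
    moreover have "(\<lambda>i. \<nu> (binaryset B C i)) sums (\<nu> B + \<nu> C)"
      by (rule binaryset_sums) (fact zero)
    ultimately show ?thesis
      by (metis UN_binaryset_eq sums_unique2)
  qed
  have P_add: "P B + P C \<le> P (B \<union> C)" if "B \<in> sets M" "C \<in> sets M" "B \<inter> C = {}" for B C
  proof -
    have "ennreal (\<nu> B') + ennreal (\<nu> C') \<le> P (B \<union> C)"
      if "B' \<in> sets M" "B' \<subseteq> B" "C' \<in> sets M" "C' \<subseteq> C" for B' C'
    proof -
      have "B' \<inter> C' = {}"
        using that \<open>B \<inter> C = {}\<close> by blast
      then have eq: "\<nu> (B' \<union> C') = \<nu> B' + \<nu> C'"
        using that by (intro add)
      have "B' \<subseteq> B \<union> C" "C' \<subseteq> B \<union> C" "B' \<union> C' \<subseteq> B \<union> C" "B' \<union> C' \<in> sets M"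
        using that by auto
      then have *: "ennreal (\<nu> B') \<le> P (B \<union> C)" "ennreal (\<nu> C') \<le> P (B \<union> C)"
          "ennreal (\<nu> B' + \<nu> C') \<le> P (B \<union> C)"
        using that upper eq by metis+
      show ?thesis
      proof (cases "\<nu> B' \<ge> 0 \<and> \<nu> C' \<ge> 0")
        case True
        then show ?thesis using * by (simp add: ennreal_plus)
      next
        case False
        then show ?thesis using * by (auto simp: ennreal_neg not_le)
      qed
    qed
    then have "ennreal (\<nu> B') + P C \<le> P (B \<union> C)" if "B' \<in> sets M" "B' \<subseteq> B" for B'
      unfolding P_def[of C] using that
      by (subst ennreal_SUP_add_right) (auto intro!: SUP_least)
    then show ?thesis
      unfolding P_def[of B]
      by (subst ennreal_SUP_add_left[symmetric]) (auto intro!: SUP_least)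
  qed
  have mono: "P B \<le> P C" if "B \<subseteq> C" for B C
    unfolding P_def using that by (intro SUP_subset_mono) auto
  have P_zero: "P {} = 0"
    unfolding P_def by (auto simp: zero bot_ennreal intro!: antisym SUP_least)
  have "countably_additive (sets M) P"
    unfolding countably_additive_def
  proof (intro allI impI antisym)
    fix F :: "nat \<Rightarrow> 'a set"
    assume F: "range F \<subseteq> sets M" "disjoint_family F" "\<Union> (range F) \<in> sets M"
    have fin: "(\<Sum>i<k. P (F i)) \<le> P (\<Union>i<k. F i)" for k
    proof (induction k)
      case 0
      then show ?case by simp
    next
      case (Suc k)
      have "(\<Sum>i<Suc k. P (F i)) \<le> P (\<Union>i<k. F i) + P (F k)"
        using Suc by (simp add: add_right_mono)
      also have "\<dots> \<le> P ((\<Union>i<k. F i) \<union> F k)"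
      proof (intro P_add)
        show "(\<Union>i<k. F i) \<inter> F k = {}"
          using F(2) unfolding disjoint_family_on_def by (metis (no_types, lifting) UN_E
            disjoint_iff iso_tuple_UNIV_I lessThan_iff less_irrefl)
      qed (use F(1) in auto)
      finally show ?case
        by (simp add: lessThan_Suc Un_commute)
    qed
    show "(\<Sum>i. P (F i)) \<le> P (\<Union> (range F))"
    proof (rule suminf_le_const)
      fix k
      show "(\<Sum>i<k. P (F i)) \<le> P (\<Union> (range F))"
        by (rule order.trans[OF fin mono]) auto
    qed simp
    show "P (\<Union> (range F)) \<le> (\<Sum>i. P (F i))"
      unfolding P_def[of "\<Union> (range F)"]
    proof (rule SUP_least)
      fix B assume B: "B \<in> {B \<in> sets M. B \<subseteq> \<Union> (range F)}"
      then have "(\<Union>i. B \<inter> F i) = B"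
        by blast
      moreover have "(\<lambda>i. \<nu> (B \<inter> F i)) sums \<nu> (\<Union>i. B \<inter> F i)"
        using B F by (intro sums) (auto simp: disjoint_family_on_def)
      ultimately have "(\<lambda>i. \<nu> (B \<inter> F i)) sums \<nu> B"
        by simp
      then have "(\<lambda>k. ennreal (\<Sum>i<k. \<nu> (B \<inter> F i))) \<longlonglongrightarrow> ennreal (\<nu> B)"
        unfolding sums_def by (rule tendsto_ennrealI)
      moreover have "ennreal (\<Sum>i<k. \<nu> (B \<inter> F i)) \<le> (\<Sum>i. P (F i))" for k
      proof -
        have "ennreal (\<Sum>i<k. \<nu> (B \<inter> F i)) \<le> ennreal (\<Sum>i<k. max 0 (\<nu> (B \<inter> F i)))"
          by (intro ennreal_leI sum_mono) auto
        also have "\<dots> = (\<Sum>i<k. ennreal (max 0 (\<nu> (B \<inter> F i))))"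
          by (rule sum_ennreal[symmetric]) simp
        also have "\<dots> = (\<Sum>i<k. ennreal (\<nu> (B \<inter> F i)))"
          by (intro sum.cong) (auto simp: max_def ennreal_neg)
        also have "\<dots> \<le> (\<Sum>i<k. P (F i))"
          using B F by (intro sum_mono upper) auto
        also have "\<dots> \<le> (\<Sum>i. P (F i))"
          by (intro sum_le_suminf) auto
        finally show ?thesis .
      qed
      ultimately show "ennreal (\<nu> B) \<le> (\<Sum>i. P (F i))"
        by (intro LIMSEQ_le_const2) auto
    qed
  qed
  then have "emeasure (measure_of (space M) (sets M) P) A = P A"
    using A P_zero sets.sigma_algebra_axioms
    by (intro emeasure_measure_of_sigma) (auto simp: positive_def)
  then show ?thesis
    unfolding upper_variation_def P_def .
qed


subsection \<open>The function class and its complexity\<close>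

definition index_pairs :: "nat \<Rightarrow> nat \<Rightarrow> (nat set \<times> nat set) set" where
  "index_pairs d s =
     {(L, U). L \<subseteq> {1..d} \<and> U \<subseteq> {1..d} \<and> 0 < card L + card U \<and> card L + card U \<le> s}"

text \<open>
  \<open>L\<close> and \<open>U\<close> may overlap, so the threshold vectors \<open>(l, u)\<close> are indexed by the disjoint sum of
  \<open>L\<close> and \<open>U\<close>: \<open>t (Inl j)\<close> is \<open>l\<^sub>j\<close> and \<open>t (Inr j)\<close> is \<open>u\<^sub>j\<close>.
\<close>

definition thresholds :: "nat set \<Rightarrow> nat set \<Rightarrow> (nat + nat \<Rightarrow> real) measure" where
  "thresholds L U = PiM (L <+> U) (\<lambda>_. borel)"

definition basis_fun ::
  "nat set \<Rightarrow> nat set \<Rightarrow> (nat + nat \<Rightarrow> real) \<Rightarrow> (nat \<Rightarrow> real) \<Rightarrow> real" where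
  "basis_fun L U t x =
     (\<Prod>j\<in>L. of_bool (x j \<ge> t (Inl j))) * (\<Prod>j\<in>U. of_bool (x j < t (Inr j)))"

type_synonym measure_family = "nat set \<Rightarrow> nat set \<Rightarrow> (nat + nat \<Rightarrow> real) set \<Rightarrow> real"

definition signed_measure_family :: "nat \<Rightarrow> nat \<Rightarrow> measure_family \<Rightarrow> bool" where
  "signed_measure_family d s \<nu> \<longleftrightarrow>
     (\<forall>(L, U)\<in>index_pairs d s. signed_measure (thresholds L U) (\<nu> L U))"

definition ensemble_fun ::
  "nat \<Rightarrow> nat \<Rightarrow> real \<Rightarrow> measure_family \<Rightarrow> (nat \<Rightarrow> real) \<Rightarrow> real" where
  "ensemble_fun d s c \<nu> x =
     c + (\<Sum>(L, U)\<in>index_pairs d s.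
            signed_integral (thresholds L U) (\<nu> L U) (\<lambda>t. basis_fun L U t x))"

definition represents ::
  "nat \<Rightarrow> nat \<Rightarrow> real \<Rightarrow> measure_family \<Rightarrow> ((nat \<Rightarrow> real) \<Rightarrow> real) \<Rightarrow> bool" where
  "represents d s c \<nu> f \<longleftrightarrow>
     signed_measure_family d s \<nu> \<and> (\<forall>x\<in>space (Rd d). ensemble_fun d s c \<nu> x = f x)"

definition F_ST :: "nat \<Rightarrow> nat \<Rightarrow> ((nat \<Rightarrow> real) \<Rightarrow> real) set" where
  "F_ST d s = {f. \<exists>c \<nu>. represents d s c \<nu> f}"

definition V_XGB :: "nat \<Rightarrow> nat \<Rightarrow> ((nat \<Rightarrow> real) \<Rightarrow> real) \<Rightarrow> ennreal" where
  "V_XGB d s f =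
     Inf {\<Sum>(L, U)\<in>index_pairs d s. tv_norm (thresholds L U) (\<nu> L U) | c \<nu>. represents d s c \<nu> f}"


subsection \<open>The regression model and the minimax risk\<close>

definition sq_norm :: "nat \<Rightarrow> ((nat \<Rightarrow> real) \<Rightarrow> real) \<Rightarrow> ((nat \<Rightarrow> real) \<Rightarrow> real) \<Rightarrow> ennreal" where
  "sq_norm d p0 g = (\<integral>\<^sup>+x. ennreal ((g x)\<^sup>2 * p0 x) \<partial>Rd d)"

definition covariate_law :: "nat \<Rightarrow> ((nat \<Rightarrow> real) \<Rightarrow> real) \<Rightarrow> (nat \<Rightarrow> real) measure" where
  "covariate_law d p0 = density (Rd d) (\<lambda>x. ennreal (p0 x))"

definition noise_law :: "real \<Rightarrow> real measure" where
  "noise_law \<sigma> = density lborel (\<lambda>z. ennreal (normal_density 0 \<sigma> z))"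

text \<open>The joint law of all covariates and noise variables; its factors are independent.\<close>

definition sample_law ::
  "nat \<Rightarrow> nat \<Rightarrow> ((nat \<Rightarrow> real) \<Rightarrow> real) \<Rightarrow> real
     \<Rightarrow> ((nat \<Rightarrow> nat \<Rightarrow> real) \<times> (nat \<Rightarrow> real)) measure" where
  "sample_law d n p0 \<sigma> =
     PiM {1..n} (\<lambda>_. covariate_law d p0) \<Otimes>\<^sub>M PiM {1..n} (\<lambda>_. noise_law \<sigma>)"

type_synonym data = "nat \<Rightarrow> (nat \<Rightarrow> real) \<times> real"

definition data_space :: "nat \<Rightarrow> nat \<Rightarrow> data measure" where
  "data_space d n = PiM {1..n} (\<lambda>_. Rd d \<Otimes>\<^sub>M lborel)"

definition observed ::
  "nat \<Rightarrow> ((nat \<Rightarrow> real) \<Rightarrow> real) \<Rightarrow> (nat \<Rightarrow> nat \<Rightarrow> real) \<Rightarrow> (nat \<Rightarrow> real) \<Rightarrow> data" where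
  "observed n f X \<xi> = (\<lambda>i\<in>{1..n}. (X i, f (X i) + \<xi> i))"

text \<open>
  Estimators are jointly measurable in the data and the evaluation point, so that the loss is a
  random variable; for a non-measurable integrand \<open>nn_integral\<close> would be a lower integral.
\<close>

definition estimators :: "nat \<Rightarrow> nat \<Rightarrow> (data \<Rightarrow> (nat \<Rightarrow> real) \<Rightarrow> real) set" where
  "estimators d n =
     {T. (\<lambda>(D, x). T D x) \<in> borel_measurable (data_space d n \<Otimes>\<^sub>M Rd d)}"

definition risk ::
  "nat \<Rightarrow> nat \<Rightarrow> ((nat \<Rightarrow> real) \<Rightarrow> real) \<Rightarrow> real
     \<Rightarrow> (data \<Rightarrow> (nat \<Rightarrow> real) \<Rightarrow> real) \<Rightarrow> ((nat \<Rightarrow> real) \<Rightarrow> real) \<Rightarrow> ennreal" where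
  "risk d n p0 \<sigma> T f =
     (\<integral>\<^sup>+(X, \<xi>). sq_norm d p0 (\<lambda>x. T (observed n f X \<xi>) x - f x) \<partial>sample_law d n p0 \<sigma>)"

definition minimax_risk ::
  "nat \<Rightarrow> nat \<Rightarrow> nat \<Rightarrow> real \<Rightarrow> ((nat \<Rightarrow> real) \<Rightarrow> real) \<Rightarrow> real \<Rightarrow> ennreal" where
  "minimax_risk d s n V p0 \<sigma> =
     (INF T\<in>estimators d n.
        SUP f\<in>{f \<in> F_ST d s. V_XGB d s f \<le> ennreal V}. risk d n p0 \<sigma> T f)"

definition cov_box :: "nat \<Rightarrow> (nat \<Rightarrow> real) \<Rightarrow> (nat \<Rightarrow> real) set" where
  "cov_box d M = PiE {1..d} (\<lambda>j. {- M j / 2 .. M j / 2})"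

definition prob_density :: "nat \<Rightarrow> ((nat \<Rightarrow> real) \<Rightarrow> real) \<Rightarrow> bool" where
  "prob_density d p0 \<longleftrightarrow>
     p0 \<in> borel_measurable (Rd d) \<and> (\<forall>x\<in>space (Rd d). 0 \<le> p0 x) \<and>
     (\<integral>\<^sup>+x. ennreal (p0 x) \<partial>Rd d) = 1"

end

theory Submission
  imports Defs
begin

text \<open>
  The hard subfamily lives on the first \<open>k = min s d\<close> coordinates, rescaled to the unit cube. On the line,
  let a wave be the difference of the two Haar functions supported on the halves of a dyadic interval,
  and let a bump be the primitive of a wave: a tent followed by its negative. For a sum of products of
  bumps over all dyadic boxes of volume \<open>2\<^sup>-\<^sup>l\<close> in polynomially many shapes, with signs \<open>\<plusminus>a\<close>, the
  representing measure has as density the corresponding sum of products of waves. Waves are orthogonal,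
  so the total variation, being an \<open>L\<^sup>1\<close> norm, is bounded by an \<open>L\<^sup>2\<close> norm that grows only like the
  square root of the number of shapes; this is where the logarithmic factor comes from.

  The bumps are not orthogonal, but they are biorthogonal to the Haar products of the same volume:
  of two different boxes of equal volume, the second is coarser than the first, or disjoint from it at
  the same scale, in some coordinate, and there the bump of the first integrates to zero against the Haar
  function of the second. Hence by Bessel's inequality the risk dominates the sum of the risks of estimating
  the single signs, and each of these is a two-point problem, whose Hellinger affinity is
  at least \<open>1/2\<close> once \<open>n a\<^sup>2 B \<le> \<sigma>\<^sup>2 8\<^sup>l\<close>. Averaging over all signs and taking the smallest
  admissible \<open>l\<close> gives the rate.
\<close>

subsection \<open>Haar functions, waves and bumps on the line\<close>

text \<open>A plain Haar density would have tents as primitives, and the nonzero mean of a tent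
  correlates with every coarser Haar function whose interval contains it. The extra sign change of a
  wave gives its primitive mean zero; this is why waves, not Haar functions, carry the representing
  measure, while Haar functions remain the test functions. The exponents come from the following
  count. With \<open>R\<close> shapes of volume 2^-l there are R 2^l signs, and the squared L2 norm
  of the density is R a^2, so the budget allows a^2 = V^2 / R. A sign is seen through a Haar
  coefficient of size a 4^-l up to a factor 8^-k, and Bessel contributes a factor 2^l; the total
  loss is therefore of order 2^l R 2^l a^2 16^-l = V^2 4^-l, from which \<open>R\<close> has
  cancelled. It enters only through the closeness condition, which becomes n V^2 B <= \<sigma>^2 R
  8^l: more shapes make coarser boxes, hence a larger loss, admissible. With \<open>R\<close> of
  order (log Z)^(k-1) for Z = n V^2 / \<sigma>^2, the balance is 8^l of order B Z / (log Z)^(k-1),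
  and taking the power 2/3 gives both exponents of the rate.\<close>

definition unif :: "real \<Rightarrow> real measure" where
  "unif M = density lborel (\<lambda>x. ennreal (indicator {- M / 2..M / 2} x / M))"

definition std :: "real \<Rightarrow> real \<Rightarrow> real" where
  "std M x = x / M + 1 / 2"

text \<open>Stated through the floor instead of an interval, so that passing to a coarser scale is
  an integer division of the index (\<open>floor_coarse\<close>).\<close>

definition cell :: "nat \<Rightarrow> int \<Rightarrow> real \<Rightarrow> real" where
  "cell m j x = of_bool (\<lfloor>2 ^ m * x\<rfloor> = j)"

definition haar :: "nat \<Rightarrow> int \<Rightarrow> real \<Rightarrow> real" where
  "haar m i x = cell (Suc m) (2 * i) x - cell (Suc m) (2 * i + 1) x"

definition tent :: "nat \<Rightarrow> int \<Rightarrow> real \<Rightarrow> real" where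
  "tent m i x = max 0 (min (x - i / 2 ^ m) ((real_of_int i + 1) / 2 ^ m - x))"

text \<open>The sign pattern on the four quarters of the dyadic interval is +, -, -, +. Both the
  mean and the first moment vanish, so the primitive is again supported in the interval and has mean
  zero.\<close>

definition wave :: "nat \<Rightarrow> int \<Rightarrow> real \<Rightarrow> real" where
  "wave m i x = haar (Suc m) (2 * i) x - haar (Suc m) (2 * i + 1) x"

definition bump :: "nat \<Rightarrow> int \<Rightarrow> real \<Rightarrow> real" where
  "bump m i x = tent (Suc m) (2 * i) x - tent (Suc m) (2 * i + 1) x"

lemma measurable_std [measurable]: "std M \<in> borel_measurable borel"
  unfolding std_def by measurable

lemma sets_unif [simp, measurable_cong]: "sets (unif M) = sets borel"
  by (simp add: unif_def)

lemma space_unif [simp]: "space (unif M) = UNIV"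
  by (simp add: unif_def)

lemma measurable_cell [measurable]: "cell m i \<in> borel_measurable borel"
  unfolding cell_def by measurable

lemma measurable_haar [measurable]: "haar m i \<in> borel_measurable borel"
  unfolding haar_def by measurable

lemma measurable_tent [measurable]: "tent m i \<in> borel_measurable borel"
  unfolding tent_def by measurable

lemma measurable_wave [measurable]: "wave m i \<in> borel_measurable borel"
  unfolding wave_def by measurable

lemma measurable_bump [measurable]: "bump m i \<in> borel_measurable borel"
  unfolding bump_def by measurable

lemma std_le_iff: "M > 0 \<Longrightarrow> std M x \<le> std M y \<longleftrightarrow> x \<le> y"
  by (simp add: std_def field_simps)

text \<open>Affine substitution x = -M/2 + M y. The support condition makes the indicator of the box
  redundant, so every rescaled integral reduces to one that is free of \<open>M\<close>.\<close>

lemma integral_unif: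
  fixes F :: "real \<Rightarrow> real"
  assumes M: "M > 0" and [measurable]: "F \<in> borel_measurable borel"
    and supp: "\<And>y. y \<notin> {0..1} \<Longrightarrow> F y = 0"
  shows "(\<integral>x. F (std M x) \<partial>unif M) = (\<integral>y. F y \<partial>lborel)"
proof -
  have "(\<integral>x. F (std M x) \<partial>unif M)
      = (\<integral>x. (indicator {- M / 2..M / 2} x / M) * F (std M x) \<partial>lborel)"
    unfolding unif_def using M by (subst integral_density) auto
  also have "\<dots> = M * (\<integral>x. (indicator {- M / 2..M / 2} (- M / 2 + M * x) / M)
      * F (std M (- M / 2 + M * x)) \<partial>lborel)"
    using M by (subst lborel_integral_real_affine[where c = M and t = "- M / 2"]) auto
  also have "\<dots> = M * (\<integral>x. F x / M \<partial>lborel)"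
  proof -
    have "(indicator {- M / 2..M / 2} (- M / 2 + M * x) / M) * F (std M (- M / 2 + M * x)) = F x / M" for x
    proof (cases "x \<in> {0..1}")
      case True
      then have "- M / 2 + M * x \<in> {- M / 2..M / 2}"
        using M by (auto simp: field_simps mult_left_le)
      moreover have "std M (- M / 2 + M * x) = x"
        using M by (simp add: std_def field_simps)
      ultimately show ?thesis by simp
    next
      case False
      moreover have "std M (- M / 2 + M * x) = x"
        using M by (simp add: std_def field_simps)
      ultimately show ?thesis using supp by simp
    qed
    then show ?thesis by (simp only:)
  qed
  finally show ?thesis using M by simp
qed

lemma prob_space_unif:
  assumes M: "M > 0"
  shows "prob_space (unif M)"
proof
  have "emeasure (unif M) (space (unif M))
      = (\<integral>\<^sup>+x. ennreal (1 / M) * indicator {- M / 2..M / 2} x \<partial>lborel)"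
    unfolding unif_def by (subst emeasure_density) (auto intro!: nn_integral_cong split: split_indicator)
  also have "\<dots> = 1"
    using M by (subst nn_integral_cmult_indicator) (auto simp: ennreal_mult[symmetric])
  finally show "emeasure (unif M) (space (unif M)) = 1" .
qed

section \<open>Primitives: from cells to tents, from waves to bumps\<close>

lemma cell_eq_indicator: "cell m j = indicator {j / 2 ^ m..<(real_of_int j + 1) / 2 ^ m}"
proof
  fix x :: real
  show "cell m j x = indicator {j / 2 ^ m..<(real_of_int j + 1) / 2 ^ m} x"
    by (auto simp: cell_def floor_eq_iff field_simps split: split_indicator)
qed

lemma integral_cell_le:
  "(\<integral>t. of_bool (t \<le> x) * cell m j t \<partial>lborel)
    = max 0 (min x ((real_of_int j + 1) / 2 ^ m) - j / 2 ^ m)"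
proof -
  have "(\<integral>t. of_bool (t \<le> x) * cell m j t \<partial>lborel)
     = (\<integral>t. indicator ({j / 2 ^ m..<(real_of_int j + 1) / 2 ^ m} \<inter> {..x}) t \<partial>lborel)"
    by (intro Bochner_Integration.integral_cong) (auto simp: cell_eq_indicator split: split_indicator)
  also have "\<dots> = measure lborel ({j / 2 ^ m..<(real_of_int j + 1) / 2 ^ m} \<inter> {..x})"
    by simp
  also have "\<dots> = max 0 (min x ((real_of_int j + 1) / 2 ^ m) - j / 2 ^ m)"
  proof -
    consider "x < j / 2 ^ m" | "j / 2 ^ m \<le> x" "x < (real_of_int j + 1) / 2 ^ m" | "(real_of_int j + 1) / 2 ^ m \<le> x" 
      by linarith
    then show ?thesis
    proof cases
      case 1
      then have "{j / 2 ^ m..<(real_of_int j + 1) / 2 ^ m} \<inter> {..x} = {}" by auto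
      then show ?thesis using 1 by simp
    next
      case 2
      then have "{j / 2 ^ m..<(real_of_int j + 1) / 2 ^ m} \<inter> {..x} = {j / 2 ^ m..x}" by auto
      then show ?thesis using 2 by simp
    next
      case 3
      have *: "(j::real) / 2 ^ m \<le> (real_of_int j + 1) / 2 ^ m" by (simp add: divide_right_mono)
      show ?thesis
      proof (cases "x = (real_of_int j + 1) / 2 ^ m")
        case True
        then have "{j / 2 ^ m..<(real_of_int j + 1) / 2 ^ m} \<inter> {..x} = {j / 2 ^ m..<(real_of_int j + 1) / 2 ^ m}" by auto
        then show ?thesis using 3 * by simp
      next
        case False
        then have "{j / 2 ^ m..<(real_of_int j + 1) / 2 ^ m} \<inter> {..x} = {j / 2 ^ m..<(real_of_int j + 1) / 2 ^ m}" using 3 by auto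
        then show ?thesis using 3 * by simp
      qed
    qed
  qed
  finally show ?thesis .
qed

lemma integrable_cell: "integrable lborel (cell m j)"
  unfolding cell_eq_indicator by (intro integrable_real_indicator) (auto simp: emeasure_lborel_Ico divide_right_mono)

lemma integral_cell: "(\<integral>t. cell m j t \<partial>lborel) = 1 / 2 ^ m"
proof -
  have "(j::real) / 2 ^ m \<le> (real_of_int j + 1) / 2 ^ m" by (simp add: divide_right_mono)
  then show ?thesis
    unfolding cell_eq_indicator by (simp add: diff_divide_distrib[symmetric])
qed

lemma integrable_cell_mult:
  assumes [measurable]: "F \<in> borel_measurable borel" and F: "\<And>x. \<bar>F x\<bar> \<le> C"
  shows "integrable lborel (\<lambda>x. F x * cell m j x)"
proof (rule Bochner_Integration.integrable_bound[OF integrable_mult_right[OF integrable_cell[of m j], of C]])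
  have "C \<ge> 0" using F[of 0] by linarith
  then show "AE x in lborel. norm (F x * cell m j x) \<le> norm (C * cell m j x)"
    using F by (auto simp: abs_mult cell_def intro!: AE_I2)
qed auto

text \<open>The factor \<open>of_bool (t \<le> x)\<close> is what \<open>basis_fun\<close>
  contributes for a lower threshold \<open>t\<close>; integrating a density against it is taking a
  primitive.\<close>

lemma integral_haar_le: "(\<integral>t. of_bool (t \<le> x) * haar m i t \<partial>lborel) = tent m i x"
proof -
  have I: "integrable lborel (\<lambda>t. of_bool (t \<le> x) * cell m j t)" for m j
    by (rule integrable_cell_mult[where C = 1]) auto
  have "(\<integral>t. of_bool (t \<le> x) * haar m i t \<partial>lborel)
     = max 0 (min x ((2 * i + 1) / 2 ^ Suc m) - 2 * i / 2 ^ Suc m)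
     - max 0 (min x ((2 * i + 2) / 2 ^ Suc m) - (2 * i + 1) / 2 ^ Suc m)"
    unfolding haar_def right_diff_distrib
    by (subst Bochner_Integration.integral_diff[OF I I]) (simp add: integral_cell_le add.commute)
  also have "\<dots> = tent m i x"
  proof -
    \<comment> \<open>In terms of the left end \<open>a\<close> and the half-length \<open>h\<close>
      all breakpoints are a, a + h, a + 2h, and the claim becomes a linear case distinction.\<close>
    define h :: real where "h = 1 / 2 ^ Suc m"
    have h: "h > 0" by (simp add: h_def)
    define a :: real where "a = i / 2 ^ m"
    have eqs: "2 * i / 2 ^ Suc m = a" "(2 * i + 1) / 2 ^ Suc m = a + h" "(2 * i + 2) / 2 ^ Suc m = a + 2 * h"
       "(real_of_int i + 1) / 2 ^ m = a + 2 * h"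
      by (simp_all add: a_def h_def field_simps)
    show ?thesis
      unfolding tent_def eqs a_def[symmetric] using h by (auto simp: max_def min_def)
  qed
  finally show ?thesis .
qed

lemma integral_wave_le: "(\<integral>t. of_bool (t \<le> x) * wave m i t \<partial>lborel) = bump m i x"
proof -
  have "integrable lborel (\<lambda>t. of_bool (t \<le> x) * cell m j t)" for m j
    by (rule integrable_cell_mult[where C = 1]) auto
  then have I: "integrable lborel (\<lambda>t. of_bool (t \<le> x) * haar m j t)" for m j
    unfolding haar_def right_diff_distrib by (intro Bochner_Integration.integrable_diff)
  show ?thesis
    unfolding wave_def bump_def right_diff_distrib
    by (subst Bochner_Integration.integral_diff[OF I I]) (simp add: integral_haar_le)
qed

section \<open>Orthogonality of Haar functions and of waves\<close>

lemma floor_coarse: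
  assumes "m' \<le> m"
  shows "\<lfloor>2 ^ m' * x\<rfloor> = \<lfloor>2 ^ m * (x::real)\<rfloor> div 2 ^ (m - m')"
proof -
  have "2 ^ m' * x = (2 ^ m * x) / real_of_int (2 ^ (m - m'))"
    using assms by (simp add: power_add[symmetric] field_simps)
  then show ?thesis
    by (simp only: floor_divide_real_eq_div zero_le_power zero_le_numeral)
qed

text \<open>The constant value of a Haar function of scale \<open>m'\<close> on the cell
  \<open>j\<close> of a finer scale \<open>m\<close>; the division finds the ancestor of
  \<open>j\<close> at scale \<open>Suc m'\<close>. Meaningful for \<open>m' < m\<close>
  only.\<close>

definition haar_on :: "nat \<Rightarrow> int \<Rightarrow> nat \<Rightarrow> int \<Rightarrow> real" where
  "haar_on m' i' m j = of_bool (j div 2 ^ (m - Suc m') = 2 * i') - of_bool (j div 2 ^ (m - Suc m') = 2 * i' + 1)"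

lemma haar_mult_cell:
  assumes "m' < m"
  shows "haar m' i' x * cell m j x = haar_on m' i' m j * cell m j x"
  using floor_coarse[of "Suc m'" m x] assms by (auto simp: haar_on_def haar_def cell_def)

lemma cell_mult_cell: "cell m j x * cell m j' x = of_bool (j = j') * cell m j x"
  by (auto simp: cell_def)

lemma cell_split: "cell m i x = cell (Suc m) (2 * i) x + cell (Suc m) (2 * i + 1) x"
  using floor_coarse[of m "Suc m" x] by (auto simp: cell_def)

lemma haar_mult_own_cell: "haar m i x * cell m i x = haar m i x"
  by (subst cell_split) (auto simp: haar_def algebra_simps cell_mult_cell)

lemma haar_sq: "haar m i x * haar m i x = cell m i x"
  by (subst cell_split) (auto simp: haar_def algebra_simps cell_mult_cell)

lemma integral_haar: "(\<integral>x. haar m i x \<partial>lborel) = 0"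
  unfolding haar_def by (subst Bochner_Integration.integral_diff[OF integrable_cell integrable_cell])
    (simp add: integral_cell)

lemma abs_haar_le: "\<bar>haar m i x\<bar> \<le> 1"
  by (auto simp: haar_def cell_def)

text \<open>The finer function lives in one cell, on which the coarser one is constant, and has mean
  zero. At equal scales the supports are disjoint unless the indices agree.\<close>

lemma integral_haar_haar:
  "(\<integral>x. haar m i x * haar m' i' x \<partial>lborel) = (if m = m' \<and> i = i' then 1 / 2 ^ m else 0)"
proof -
  have less: "(\<integral>x. haar m i x * haar m' i' x \<partial>lborel) = 0" if "m' < m" for m m' i i'
  proof -
    have "haar m i x * haar m' i' x = haar_on m' i' m i * haar m i x" for x
    proof -
      have "haar m i x * haar m' i' x = haar m i x * (haar m' i' x * cell m i x)"
        using haar_mult_own_cell[of m i x] by (simp add: mult_ac)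
      also have "\<dots> = haar_on m' i' m i * (haar m i x * cell m i x)"
        using haar_mult_cell[OF that, of i' x i] by simp
      finally show ?thesis
        by (simp only: haar_mult_own_cell)
    qed
    then show ?thesis by (simp only: integral_mult_right_zero integral_haar mult_zero_right)
  qed
  consider "m' < m" | "m < m'" | "m = m'" "i \<noteq> i'" | "m = m'" "i = i'" by linarith
  then show ?thesis
  proof cases
    case 1 then show ?thesis by (simp add: less)
  next
    case 2 then show ?thesis using less[of m m' i' i] by (simp add: mult.commute)
  next
    case 3
    have "haar m i x * haar m i' x = 0" for x
      using 3 by (auto simp: haar_def cell_def)
    then have "(\<integral>x. haar m i x * haar m i' x \<partial>lborel) = 0"
      by (simp only: Bochner_Integration.integral_zero)
    then show ?thesis using 3 by simp
  next
    case 4 then show ?thesis by (simp add: haar_sq integral_cell)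
  qed
qed

lemma integrable_haar_haar: "integrable lborel (\<lambda>x. haar m i x * haar m' i' x)"
proof -
  have "integrable lborel (\<lambda>x. haar m i x * cell m' j x)" for j m'
    by (rule integrable_cell_mult[OF _ abs_haar_le]) auto
  then show ?thesis
    unfolding haar_def[of m' i'] right_diff_distrib by (intro Bochner_Integration.integrable_diff)
qed

lemma integral_wave_wave:
  "(\<integral>x. wave m i x * wave m' i' x \<partial>lborel) = (if m = m' \<and> i = i' then 1 / 2 ^ m else 0)"
proof -
  have "(\<integral>x. wave m i x * wave m' i' x \<partial>lborel)
     = (\<integral>x. haar (Suc m) (2*i) x * haar (Suc m') (2*i') x - haar (Suc m) (2*i) x * haar (Suc m') (2*i'+1) x
       - (haar (Suc m) (2*i+1) x * haar (Suc m') (2*i') x - haar (Suc m) (2*i+1) x * haar (Suc m') (2*i'+1) x) \<partial>lborel)"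
    unfolding wave_def by (simp add: algebra_simps)
  also have "\<dots> = (\<integral>x. haar (Suc m) (2*i) x * haar (Suc m') (2*i') x \<partial>lborel) - (\<integral>x. haar (Suc m) (2*i) x * haar (Suc m') (2*i'+1) x \<partial>lborel)
       - ((\<integral>x. haar (Suc m) (2*i+1) x * haar (Suc m') (2*i') x \<partial>lborel) - (\<integral>x. haar (Suc m) (2*i+1) x * haar (Suc m') (2*i'+1) x \<partial>lborel))"
    by (simp only: Bochner_Integration.integral_diff Bochner_Integration.integrable_diff integrable_haar_haar)
  also have "\<dots> = (if m = m' \<and> i = i' then 1 / 2 ^ m else 0)"
  proof -
    \<comment> \<open>An even child never equals an odd one, so of the four Haar pairings only the
      two diagonal ones survive, each worth 1 / 2^(m+1).\<close>
    have "2 * i \<noteq> 2 * i' + 1" "2 * i + 1 \<noteq> 2 * i'" by presburger+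
    then show ?thesis
      unfolding integral_haar_haar by simp
  qed
  finally show ?thesis .
qed

section \<open>Bumps tested against Haar functions\<close>

lemma tent_mult_cell: "tent m i x * cell m i x = tent m i x"
proof (cases "cell m i x = 1")
  case False
  then have "x < i / 2 ^ m \<or> (real_of_int i + 1) / 2 ^ m \<le> x"
    by (auto simp: cell_eq_indicator split: split_indicator_asm)
  then show ?thesis by (auto simp: tent_def)
qed simp

lemma tent_nonneg: "0 \<le> tent m i x"
  by (simp add: tent_def)

lemma tent_le: "tent m i x \<le> 1 / 2 ^ Suc m"
proof -
  have "(real_of_int i + 1) / 2 ^ m = i / 2 ^ m + 2 * (1 / 2 ^ Suc m)"
    by (simp add: field_simps)
  moreover have "(1::real) / 2 ^ Suc m > 0" by simp
  ultimately show ?thesis unfolding tent_def by (auto simp: max_def min_def)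
qed

lemma tent_affine: "tent m i x = tent 0 0 (2 ^ m * x - i) / 2 ^ m"
proof -
  have "tent 0 0 (2 ^ m * x - i) / 2 ^ m
      = max (0 / 2 ^ m) (min ((2 ^ m * x - i) / 2 ^ m) ((1 - (2 ^ m * x - i)) / 2 ^ m))"
    by (simp add: tent_def max_divide_distrib_right min_divide_distrib_right)
  also have "(2 ^ m * x - i) / 2 ^ m = x - i / 2 ^ m"
    by (simp add: field_simps)
  also have "(1 - (2 ^ m * x - i)) / 2 ^ m = (real_of_int i + 1) / 2 ^ m - x"
    by (simp add: field_simps)
  finally show ?thesis
    by (simp add: tent_def)
qed

lemma integrable_tent: "integrable lborel (tent m i)"
proof -
  have "\<bar>tent m i x\<bar> \<le> 1 / 2 ^ Suc m" for x
    using tent_le tent_nonneg by (simp add: abs_of_nonneg del: power_Suc)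
  from integrable_cell_mult[OF measurable_tent this, of m i] show ?thesis
    unfolding tent_mult_cell by simp
qed

lemma integral_tent_unit: "(\<integral>x. tent 0 0 x \<partial>lborel) = 1 / 4"
proof -
  have 1: "has_bochner_integral lborel (\<lambda>x::real. x * indicator {0..1/2} x) ((1/2)^2 / 2 - 0^2 / 2)"
    by (rule has_bochner_integral_FTC_Icc_real)
      (auto intro!: derivative_eq_intros continuous_intros simp: field_simps)
  have 2: "has_bochner_integral lborel (\<lambda>x::real. (1 - x) * indicator {1/2..1} x)
      ((1 - 1^2 / 2) - (1/2 - (1/2)^2 / 2))"
    by (rule has_bochner_integral_FTC_Icc_real[where F = "\<lambda>x. x - x^2 / 2"])
      (auto intro!: derivative_eq_intros continuous_intros simp: field_simps)
  \<comment> \<open>At 1/2 the two closed pieces overlap and their sum is twice the tent, hence only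
    almost everywhere.\<close>
  have AE: "AE x in lborel. tent 0 0 x = x * indicator {0..1/2} x + (1 - x) * indicator {1/2..1} x"
  proof (rule AE_I'[where N = "{1/2}"])
    show "{x \<in> space lborel. tent 0 0 x \<noteq> x * indicator {0..1/2} x + (1 - x) * indicator {1/2..1} x} \<subseteq> {1/2}"
      by (auto simp: tent_def split: split_indicator)
  qed auto
  have "(\<integral>x. tent 0 0 x \<partial>lborel) = (\<integral>x. x * indicator {0..1/2} x + (1 - x) * indicator {1/2..1} x \<partial>lborel)"
    by (rule integral_cong_AE[OF _ _ AE]) auto
  also have "\<dots> = ((1/2)^2 / 2 - 0^2 / 2) + ((1 - 1^2 / 2) - (1/2 - (1/2)^2 / 2))"
    by (rule has_bochner_integral_integral_eq[OF has_bochner_integral_add[OF 1 2]])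
  finally show ?thesis by (simp add: power2_eq_square)
qed

lemma integral_tent: "(\<integral>x. tent m i x \<partial>lborel) = 1 / (4 * 4 ^ m)"
proof -
  have "(\<integral>x. tent m i x \<partial>lborel) = 1 / 2 ^ m * (\<integral>x. tent m i (i / 2 ^ m + 1 / 2 ^ m * x) \<partial>lborel)"
    by (subst lborel_integral_real_affine[where c = "1 / 2 ^ m" and t = "i / 2 ^ m"]) auto
  also have "(\<lambda>x. tent m i (i / 2 ^ m + 1 / 2 ^ m * x)) = (\<lambda>x. tent 0 0 x / 2 ^ m)"
    by (subst tent_affine) (simp add: field_simps)
  also have "1 / 2 ^ m * (\<integral>x. tent 0 0 x / 2 ^ m \<partial>lborel) = 1 / (4 * 4 ^ m)"
    using power_mult_distrib[of "2::real" 2 m] by (simp add: integral_tent_unit field_simps)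
  finally show ?thesis .
qed

text \<open>On either half of the interval of the bump the Haar function is constant. If it is
  strictly coarser, both constants agree and the two tents cancel; for the same box they are 1 and
  -1, and the tents of area 1 / (16 * 4^m) add up. For finer Haar functions the pairing need not
  vanish, so the biorthogonality is one-sided.\<close>

lemma integral_bump_haar:
  assumes "m' < m \<or> m' = m"
  shows "(\<integral>x. bump m i x * haar m' i' x \<partial>lborel) = (if m' = m \<and> i' = i then 1 / (8 * 4 ^ m) else 0)"
proof -
  have eq: "tent (Suc m) j x * haar m' i' x = haar_on m' i' (Suc m) j * tent (Suc m) j x" for j x
  proof -
    have "tent (Suc m) j x * haar m' i' x = tent (Suc m) j x * (haar m' i' x * cell (Suc m) j x)"
      using tent_mult_cell[of "Suc m" j x] by (simp add: mult_ac)
    also have "\<dots> = haar_on m' i' (Suc m) j * tent (Suc m) j x"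
      using assms by (subst haar_mult_cell) (use tent_mult_cell[of "Suc m" j x] in \<open>auto simp: mult_ac\<close>)
    finally show ?thesis .
  qed
  have "(\<integral>x. bump m i x * haar m' i' x \<partial>lborel)
      = (\<integral>x. haar_on m' i' (Suc m) (2 * i) * tent (Suc m) (2 * i) x
          - haar_on m' i' (Suc m) (2 * i + 1) * tent (Suc m) (2 * i + 1) x \<partial>lborel)"
    unfolding bump_def left_diff_distrib eq ..
  also have "\<dots> = (haar_on m' i' (Suc m) (2 * i) - haar_on m' i' (Suc m) (2 * i + 1)) / (16 * 4 ^ m)"
    by (subst Bochner_Integration.integral_diff) (auto simp: integrable_tent integral_tent diff_divide_distrib)
  also have "\<dots> = (if m' = m \<and> i' = i then 1 / (8 * 4 ^ m) else 0)"
  proof (cases "m' = m")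
    case True
    have "2 * i \<noteq> 2 * i' + 1" "2 * i + 1 \<noteq> 2 * i'" by presburger+
    then show ?thesis using True by (auto simp: haar_on_def)
  next
    case False
    then obtain r where r: "Suc m - Suc m' = Suc r"
      using assms by (metis Suc_diff_Suc Suc_less_eq diff_Suc_Suc)
    \<comment> \<open>The two halves have the same ancestor as soon as one goes up at least one
      level.\<close>
    have "(2 * i + 1) div 2 ^ Suc r = 2 * i div 2 ^ Suc r"
      by (simp add: zdiv_zmult2_eq)
    then have "haar_on m' i' (Suc m) (2 * i + 1) = haar_on m' i' (Suc m) (2 * i)"
      by (simp only: haar_on_def r)
    then show ?thesis using False by simp
  qed
  finally show ?thesis .
qed

lemma wave_sq: "wave m i x * wave m i x = cell m i x"
proof -
  have *: "haar (Suc m) (2*i) x * haar (Suc m) (2*i+1) x = 0"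
    by (auto simp: haar_def cell_def)
  have "wave m i x * wave m i x = haar (Suc m) (2*i) x * haar (Suc m) (2*i) x
      + haar (Suc m) (2*i+1) x * haar (Suc m) (2*i+1) x"
    using * unfolding wave_def by (simp add: algebra_simps)
  then show ?thesis by (simp add: haar_sq cell_split[of m])
qed

text \<open>A crude height bound 2^-m together with the support. Integrated over a cell of length
  2^-m it yields the factor 8^-m that ends up in the closeness condition.\<close>

lemma bump_sq_le: "(bump m i x)\<^sup>2 \<le> cell m i x / 4 ^ m"
proof -
  have b: "\<bar>bump m i x\<bar> \<le> 1 / 2 ^ m"
  proof -
    have "1 / 2 ^ Suc (Suc m) \<le> (1::real) / 2 ^ m" by (simp add: field_simps)
    then show ?thesis
      using tent_le[of "Suc m" "2*i" x] tent_le[of "Suc m" "2*i+1" x] tent_nonneg[of "Suc m" "2*i" x]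
        tent_nonneg[of "Suc m" "2*i+1" x]
      unfolding bump_def by linarith
  qed
  show ?thesis
  proof (cases "cell m i x = 1")
    case True
    have "\<bar>bump m i x\<bar> ^ 2 \<le> (1 / 2 ^ m) ^ 2" using b by (intro power_mono) auto
    also have "\<dots> = 1 / 4 ^ m" by (simp add: power_divide power_mult[symmetric] mult.commute[of m])
      (simp add: power_mult)
    finally show ?thesis using True by simp
  next
    case False
    then have "cell m i x = 0" by (auto simp: cell_def)
    then have "cell (Suc m) (2*i) x = 0" "cell (Suc m) (2*i+1) x = 0"
      using cell_split[of m i x] by (auto simp: cell_def)
    then have "bump m i x = 0"
      unfolding bump_def using tent_mult_cell by (metis diff_zero mult_zero_right)
    then show ?thesis using \<open>cell m i x = 0\<close> by simp
  qed
qed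

lemma cell_support:
  assumes "cell m i x \<noteq> 0" "i \<in> {0..<2 ^ m}"
  shows "x \<in> {0..1}"
proof -
  have i: "\<lfloor>2 ^ m * x\<rfloor> = i" using assms(1) by (auto simp: cell_def)
  then have "0 \<le> 2 ^ m * x" using assms(2) by (metis atLeastLessThan_iff zero_le_floor)
  moreover have "2 ^ m * x < 2 ^ m"
    using i assms(2) by (metis atLeastLessThan_iff floor_less_iff of_int_numeral of_int_power)
  moreover have "(0::real) < 2 ^ m" by simp
  ultimately show ?thesis
    by (metis atLeastAtMost_iff less_eq_real_def mult.right_neutral mult_less_cancel_left_pos zero_le_mult_iff not_less)
qed

subsection \<open>Two-point bound for Gaussian regression\<close>

lemma ennreal_le_add_cancel:
  assumes le: "ennreal (a + b) \<le> R + ennreal b" and nonneg: "a \<ge> 0" "b \<ge> 0"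
  shows "ennreal a \<le> R"
proof (cases R)
  case (real r)
  then have "ennreal (a + b) \<le> ennreal (r + b)"
    using le nonneg by (simp only: ennreal_plus)
  then have "a + b \<le> r + b"
    using real nonneg by (subst (asm) ennreal_le_iff) auto
  then show ?thesis using real by (simp add: ennreal_leI)
qed simp

text \<open>Both sides agree on measurable rectangles, which determine a finite product of
  sigma-finite measures.\<close>

lemma distr_PiM_componentwise:
  assumes fin: "finite I"
    and M: "\<And>i. prob_space (M i)"
    and g [measurable]: "\<And>i. i \<in> I \<Longrightarrow> g i \<in> measurable (M i) (N i)"
    and K: "\<And>i. sigma_finite_measure (K i)" "\<And>i. i \<in> I \<Longrightarrow> distr (M i) (N i) (g i) = K i"
    and N: "\<And>i. i \<in> I \<Longrightarrow> sets (N i) = sets (K i)"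
  shows "distr (PiM I M) (PiM I N) (\<lambda>x. \<lambda>i\<in>I. g i (x i)) = PiM I K"
proof -
  interpret K: product_sigma_finite K using K(1) by (simp add: product_sigma_finite_def)
  interpret M: product_prob_space M by (intro product_prob_spaceI M)
  show ?thesis
  proof (rule K.PiM_eqI[OF fin])
    show "sets (distr (PiM I M) (PiM I N) (\<lambda>x. \<lambda>i\<in>I. g i (x i))) = sets (PiM I K)"
      using N by (simp cong: sets_PiM_cong)
    fix A assume A: "\<And>i. i \<in> I \<Longrightarrow> A i \<in> sets (K i)"
    have A': "A i \<in> sets (N i)" if "i \<in> I" for i using A N that by simp
    have meas: "(\<lambda>x. \<lambda>i\<in>I. g i (x i)) \<in> measurable (PiM I M) (PiM I N)"
      by measurable
    have "emeasure (distr (PiM I M) (PiM I N) (\<lambda>x. \<lambda>i\<in>I. g i (x i))) (Pi\<^sub>E I A)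
        = emeasure (PiM I M) ((\<lambda>x. \<lambda>i\<in>I. g i (x i)) -` Pi\<^sub>E I A \<inter> space (PiM I M))"
      using A' fin by (intro emeasure_distr meas) (auto intro!: sets_PiM_I_finite)
    also have "(\<lambda>x. \<lambda>i\<in>I. g i (x i)) -` Pi\<^sub>E I A \<inter> space (PiM I M)
        = Pi\<^sub>E I (\<lambda>i. g i -` A i \<inter> space (M i))"
      by (auto simp: space_PiM PiE_iff)
    also have "emeasure (PiM I M) \<dots> = (\<Prod>i\<in>I. emeasure (M i) (g i -` A i \<inter> space (M i)))"
      using A' fin by (intro M.emeasure_PiM) auto
    also have "\<dots> = (\<Prod>i\<in>I. emeasure (K i) (A i))"
      using A' by (intro prod.cong refl) (simp add: K(2)[symmetric] emeasure_distr)
    finally show "emeasure (distr (PiM I M) (PiM I N) (\<lambda>x. \<lambda>i\<in>I. g i (x i))) (Pi\<^sub>E I A)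
        = (\<Prod>i\<in>I. emeasure (K i) (A i))" .
  qed
qed

lemma PiM_density:
  assumes fin: "finite I"
    and M: "\<And>i. sigma_finite_measure (M i)"
    and f [measurable]: "\<And>i. i \<in> I \<Longrightarrow> f i \<in> borel_measurable (M i)"
    and D: "\<And>i. sigma_finite_measure (density (M i) (f i))"
  shows "PiM I (\<lambda>i. density (M i) (f i)) = density (PiM I M) (\<lambda>x. \<Prod>i\<in>I. f i (x i))"
proof -
  interpret M: product_sigma_finite M using M by (simp add: product_sigma_finite_def)
  interpret D: product_sigma_finite "\<lambda>i. density (M i) (f i)" using D by (simp add: product_sigma_finite_def)
  show ?thesis
  proof (rule D.PiM_eqI[OF fin, symmetric])
    show "sets (density (PiM I M) (\<lambda>x. \<Prod>i\<in>I. f i (x i))) = sets (PiM I (\<lambda>i. density (M i) (f i)))"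
      by (simp cong: sets_PiM_cong)
    fix A assume A: "\<And>i. i \<in> I \<Longrightarrow> A i \<in> sets (density (M i) (f i))"
    then have [measurable]: "\<And>i. i \<in> I \<Longrightarrow> A i \<in> sets (M i)" by simp
    have [measurable]: "Pi\<^sub>E I A \<in> sets (PiM I M)" using A fin by (intro sets_PiM_I_finite) auto
    have "emeasure (density (PiM I M) (\<lambda>x. \<Prod>i\<in>I. f i (x i))) (Pi\<^sub>E I A)
        = (\<integral>\<^sup>+x. (\<Prod>i\<in>I. f i (x i)) * indicator (Pi\<^sub>E I A) x \<partial>PiM I M)"
      by (rule emeasure_density) (auto intro: fin)
    also have "\<dots> = (\<integral>\<^sup>+x. (\<Prod>i\<in>I. f i (x i) * indicator (A i) (x i)) \<partial>PiM I M)"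
    proof (rule nn_integral_cong)
      fix x assume x: "x \<in> space (PiM I M)"
      then have "indicator (Pi\<^sub>E I A) x = (\<Prod>i\<in>I. indicator (A i) (x i) :: ennreal)"
        using fin by (auto simp: space_PiM PiE_iff indicator_def prod_zero_iff)
      then show "(\<Prod>i\<in>I. f i (x i)) * indicator (Pi\<^sub>E I A) x = (\<Prod>i\<in>I. f i (x i) * indicator (A i) (x i))"
        by (simp add: prod.distrib)
    qed
    also have "\<dots> = (\<Prod>i\<in>I. \<integral>\<^sup>+x. f i x * indicator (A i) x \<partial>M i)"
      by (rule M.product_nn_integral_prod[OF fin]) measurable
    also have "\<dots> = (\<Prod>i\<in>I. emeasure (density (M i) (f i)) (A i))"
      by (intro prod.cong refl) (simp add: emeasure_density)
    finally show "emeasure (density (PiM I M) (\<lambda>x. \<Prod>i\<in>I. f i (x i))) (Pi\<^sub>E I A)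
        = (\<Prod>i\<in>I. emeasure (density (M i) (f i)) (A i))" .
  qed
qed

lemma normal_shift:
  "distr (noise_law \<sigma>) lborel (\<lambda>x. c + x) = density lborel (\<lambda>x. ennreal (normal_density c \<sigma> x))"
proof (rule measure_eqI)
  fix A assume "A \<in> sets (distr (noise_law \<sigma>) lborel (\<lambda>x. c + x))"
  then have [measurable]: "A \<in> sets borel" by simp
  have [measurable]: "(\<lambda>x. c + x) -` A \<in> sets borel"
    using measurable_sets[of "\<lambda>x. c + x" borel borel A] by simp
  have "emeasure (density lborel (\<lambda>x. ennreal (normal_density c \<sigma> x))) A
      = (\<integral>\<^sup>+x. ennreal (normal_density c \<sigma> x) * indicator A x \<partial>lborel)"
    by (rule emeasure_density) auto
  also have "\<dots> = (\<integral>\<^sup>+x. ennreal (normal_density c \<sigma> (c + x)) * indicator A (c + x) \<partial>lborel)"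
    by (subst nn_integral_real_affine[where c = 1 and t = c]) auto
  also have "\<dots> = (\<integral>\<^sup>+x. ennreal (normal_density 0 \<sigma> x) * indicator ((\<lambda>x. c + x) -` A) x \<partial>lborel)"
    by (intro nn_integral_cong) (auto simp: normal_density_def split: split_indicator)
  also have "\<dots> = emeasure (distr (noise_law \<sigma>) lborel (\<lambda>x. c + x)) A"
    unfolding noise_law_def by (simp add: emeasure_distr emeasure_density)
  finally show "emeasure (distr (noise_law \<sigma>) lborel (\<lambda>x. c + x)) A
      = emeasure (density lborel (\<lambda>x. ennreal (normal_density c \<sigma> x))) A" by simp
qed simp

lemma prob_space_noise_law: "\<sigma> > 0 \<Longrightarrow> prob_space (noise_law \<sigma>)"
  unfolding noise_law_def by (rule prob_space_normal_density)

lemma sets_noise_law [simp, measurable_cong]: "sets (noise_law \<sigma>) = sets borel"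
  by (simp add: noise_law_def)

lemma space_noise_law [simp]: "space (noise_law \<sigma>) = UNIV"
  by (simp add: noise_law_def)

text \<open>Moves the regression function out of the argument of the statistic and into a
  likelihood. Two hypotheses then become two densities over the same responses \<open>y\<close>,
  which can be compared pointwise.\<close>

lemma nn_integral_noise_shift:
  assumes \<sigma>: "\<sigma> > 0" and fin: "finite I" and [measurable]: "\<Psi> \<in> borel_measurable (PiM I (\<lambda>_. lborel))"
  shows "(\<integral>\<^sup>+\<xi>. \<Psi> (\<lambda>i\<in>I. c i + \<xi> i) \<partial>PiM I (\<lambda>_. noise_law \<sigma>))
       = (\<integral>\<^sup>+y. ennreal (\<Prod>i\<in>I. normal_density (c i) \<sigma> (y i)) * \<Psi> y \<partial>PiM I (\<lambda>_. lborel))"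
proof -
  let ?K = "\<lambda>i. density lborel (\<lambda>x. ennreal (normal_density (c i) \<sigma> x))"
  have prod_eq: "(\<Prod>i\<in>I. ennreal (normal_density (c i) \<sigma> (y i))) = ennreal (\<Prod>i\<in>I. normal_density (c i) \<sigma> (y i))" for y
    by (rule prod_ennreal) simp
  have K: "sigma_finite_measure (?K i)" for i
    by (intro prob_space_imp_sigma_finite prob_space_normal_density \<sigma>)
  have "(\<integral>\<^sup>+\<xi>. \<Psi> (\<lambda>i\<in>I. c i + \<xi> i) \<partial>PiM I (\<lambda>_. noise_law \<sigma>))
      = (\<integral>\<^sup>+y. \<Psi> y \<partial>distr (PiM I (\<lambda>_. noise_law \<sigma>)) (PiM I (\<lambda>_. lborel)) (\<lambda>\<xi>. \<lambda>i\<in>I. c i + \<xi> i))"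
    by (rule nn_integral_distr[symmetric]) measurable
  also have "distr (PiM I (\<lambda>_. noise_law \<sigma>)) (PiM I (\<lambda>_. lborel)) (\<lambda>\<xi>. \<lambda>i\<in>I. c i + \<xi> i) = PiM I ?K"
    using fin \<sigma> K by (intro distr_PiM_componentwise) (auto simp: prob_space_noise_law normal_shift)
  also have "\<dots> = density (PiM I (\<lambda>_. lborel)) (\<lambda>x. \<Prod>i\<in>I. ennreal (normal_density (c i) \<sigma> (x i)))"
    by (rule PiM_density[OF fin _ _ K]) (auto intro: lborel.sigma_finite_measure_axioms)
  also have "(\<integral>\<^sup>+y. \<Psi> y \<partial>\<dots>) = (\<integral>\<^sup>+y. (\<Prod>i\<in>I. ennreal (normal_density (c i) \<sigma> (y i))) * \<Psi> y \<partial>PiM I (\<lambda>_. lborel))"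
    using fin by (intro nn_integral_density) measurable
  finally show ?thesis
    unfolding prod_eq .
qed

lemma nn_integral_prod_normal:
  assumes \<sigma>: "\<sigma> > 0" and fin: "finite I"
  shows "(\<integral>\<^sup>+y. ennreal (\<Prod>i\<in>I. normal_density (c i) \<sigma> (y i)) \<partial>PiM I (\<lambda>_. lborel)) = 1"
proof -
  interpret product_prob_space "\<lambda>_. noise_law \<sigma>"
    by (intro product_prob_spaceI prob_space_noise_law \<sigma>)
  show ?thesis
    using nn_integral_noise_shift[OF \<sigma> fin, of "\<lambda>_. 1" c] emeasure_space_1 by simp
qed

text \<open>Completing the square: with c = (a + b)/2 one has (y - a)^2 + (y - b)^2 = 2 (y - c)^2 +
  (a - b)^2 / 2. The exponential factor is the Hellinger affinity of the two normal laws.\<close>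

lemma normal_density_geometric_mean:
  assumes "\<sigma> > 0"
  shows "(normal_density ((a + b) / 2) \<sigma> y * exp (- (a - b)\<^sup>2 / (8 * \<sigma>\<^sup>2)))\<^sup>2
    = normal_density a \<sigma> y * normal_density b \<sigma> y"
proof -
  have "2 * (- (y - (a + b) / 2)\<^sup>2 / (2 * \<sigma>\<^sup>2) + - (a - b)\<^sup>2 / (8 * \<sigma>\<^sup>2))
      = - (y - a)\<^sup>2 / (2 * \<sigma>\<^sup>2) + - (y - b)\<^sup>2 / (2 * \<sigma>\<^sup>2)"
    using assms by (simp add: field_simps power2_eq_square)
  then have "(exp (- (y - (a + b) / 2)\<^sup>2 / (2 * \<sigma>\<^sup>2)) * exp (- (a - b)\<^sup>2 / (8 * \<sigma>\<^sup>2)))\<^sup>2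
      = exp (- (y - a)\<^sup>2 / (2 * \<sigma>\<^sup>2)) * exp (- (y - b)\<^sup>2 / (2 * \<sigma>\<^sup>2))"
    by (simp only: exp_add[symmetric] exp_double[symmetric])
  then show ?thesis
    by (simp add: normal_density_def power_mult_distrib power2_eq_square mult_ac)
qed

text \<open>AM-GM, using \<open>2 \<kappa> = (w + \<kappa>) - (w - \<kappa>)\<close>; \<open>r\<close> is the geometric mean of the two densities.\<close>

lemma two_point_pointwise:
  fixes p q r w \<kappa> :: real
  assumes "p \<ge> 0" "q \<ge> 0" "r \<ge> 0" "r\<^sup>2 = p * q"
  shows "2 * \<kappa>\<^sup>2 * r \<le> p * (w - \<kappa>)\<^sup>2 + q * (w + \<kappa>)\<^sup>2 + \<kappa>\<^sup>2 / 4 * (p + q)"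
proof -
  define s t where "s = sqrt p" and "t = sqrt q"
  have st: "p = s\<^sup>2" "q = t\<^sup>2" "r = s * t" "s \<ge> 0" "t \<ge> 0"
    using assms by (auto simp: s_def t_def real_sqrt_mult[symmetric])
      (metis real_sqrt_mult real_sqrt_unique)
  have "s\<^sup>2 * (w - \<kappa>)\<^sup>2 + t\<^sup>2 * (w + \<kappa>)\<^sup>2 + \<kappa>\<^sup>2 / 4 * (s\<^sup>2 + t\<^sup>2) - 2 * \<kappa>\<^sup>2 * (s * t)
      = (t * (w + \<kappa>) - \<kappa> * s / 2)\<^sup>2 + (s * (w - \<kappa>) + \<kappa> * t / 2)\<^sup>2"
    by (simp add: power2_eq_square field_simps)
  also have "\<dots> \<ge> 0"
    by simp
  finally show ?thesis
    unfolding st by simp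
qed

text \<open>\<open>W\<close> is an arbitrary statistic that should be near \<kappa> under
  \<open>f\<close> and near -\<kappa> under \<open>f'\<close>. The inequality
  \<open>two_point_pointwise\<close> is integrated with the two likelihoods as p and q: the left
  side gives 2 \<kappa>^2 times the affinity, at least \<kappa>^2, and the correction term costs
  \<kappa>^2 / 4 for each of the two probability densities.\<close>

lemma risk_two_point:
  fixes f f' :: "(nat \<Rightarrow> real) \<Rightarrow> real"
  assumes P: "prob_space P" and \<sigma>: "\<sigma> > 0"
    and [measurable]: "f \<in> borel_measurable P" "f' \<in> borel_measurable P"
    and W [measurable]: "W \<in> borel_measurable (PiM {1..n} (\<lambda>_. P \<Otimes>\<^sub>M lborel))"
    and close: "(\<integral>\<^sup>+x. ennreal ((f x - f' x)\<^sup>2) \<partial>P) \<le> ennreal \<delta>" "real n * \<delta> \<le> 4 * \<sigma>\<^sup>2" "\<delta> \<ge> 0"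
  defines "S \<equiv> PiM {1..n} (\<lambda>_. P) \<Otimes>\<^sub>M PiM {1..n} (\<lambda>_. noise_law \<sigma>)"
  shows "ennreal (\<kappa>\<^sup>2 / 2) \<le> (\<integral>\<^sup>+(X, \<xi>). ennreal ((W (observed n f X \<xi>) - \<kappa>)\<^sup>2) \<partial>S)
      + (\<integral>\<^sup>+(X, \<xi>). ennreal ((W (observed n f' X \<xi>) + \<kappa>)\<^sup>2) \<partial>S)"
proof -
  note One_nat_def [simp del]
  let ?I = "{1..n}"
  let ?L = "PiM ?I (\<lambda>_. lborel :: real measure)"
  let ?P = "PiM ?I (\<lambda>_. P)"
  interpret P: prob_space P by (rule P)
  interpret PP: product_prob_space "\<lambda>_. P" ?I by (intro product_prob_spaceI P)
  interpret NN: product_prob_space "\<lambda>_. noise_law \<sigma>" ?I by (intro product_prob_spaceI prob_space_noise_law \<sigma>)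
  interpret LL: product_sigma_finite "\<lambda>_. lborel :: real measure" by standard
  interpret L: sigma_finite_measure ?L by (rule LL.sigma_finite) simp
  define D where "D X y = (\<lambda>i\<in>?I. (X i, y i))" for X :: "nat \<Rightarrow> nat \<Rightarrow> real" and y :: "nat \<Rightarrow> real"
  \<comment> \<open>\<open>p g X\<close> is the likelihood of the responses given the covariates
    under \<open>g\<close>, and \<open>e X\<close> below is the Hellinger affinity of the two
    likelihoods given the covariates.\<close>
  define p where "p g X y = (\<Prod>i\<in>?I. normal_density (g (X i)) \<sigma> (y i))" for g :: "(nat \<Rightarrow> real) \<Rightarrow> real" and X y
  define e where "e X = (\<Prod>i\<in>?I. exp (- (f (X i) - f' (X i))\<^sup>2 / (8 * \<sigma>\<^sup>2)))" for X
  have D [measurable]: "(\<lambda>(X, y). D X y) \<in> measurable (?P \<Otimes>\<^sub>M ?L) (PiM ?I (\<lambda>_. P \<Otimes>\<^sub>M lborel))"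
    unfolding D_def by measurable
  have p_meas [measurable]: "(\<lambda>(X, y). p g X y) \<in> borel_measurable (?P \<Otimes>\<^sub>M ?L)"
    if [measurable]: "g \<in> borel_measurable P" for g
    unfolding p_def normal_density_def by measurable
  have e_meas [measurable]: "e \<in> borel_measurable ?P"
    unfolding e_def by measurable
  have change: "(\<integral>\<^sup>+(X, \<xi>). ennreal (G (W (observed n g X \<xi>))) \<partial>S)
      = (\<integral>\<^sup>+X. \<integral>\<^sup>+y. ennreal (p g X y) * ennreal (G (W (D X y))) \<partial>?L \<partial>?P)"
    if [measurable]: "g \<in> borel_measurable P" "G \<in> borel_measurable borel" for g and G :: "real \<Rightarrow> real"
  proof -
    have [measurable]: "(\<lambda>(X, \<xi>). observed n g X \<xi>)
        \<in> measurable (?P \<Otimes>\<^sub>M PiM ?I (\<lambda>_. noise_law \<sigma>)) (PiM ?I (\<lambda>_. P \<Otimes>\<^sub>M lborel))"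
      unfolding observed_def by measurable
    have "(\<integral>\<^sup>+(X, \<xi>). ennreal (G (W (observed n g X \<xi>))) \<partial>S)
        = (\<integral>\<^sup>+X. \<integral>\<^sup>+\<xi>. ennreal (G (W (observed n g X \<xi>))) \<partial>PiM ?I (\<lambda>_. noise_law \<sigma>) \<partial>?P)"
    proof -
      have "(\<lambda>(X, \<xi>). ennreal (G (W (observed n g X \<xi>)))) \<in> borel_measurable (?P \<Otimes>\<^sub>M PiM ?I (\<lambda>_. noise_law \<sigma>))"
        by measurable
      from NN.nn_integral_fst[OF this] show ?thesis
        unfolding S_def by simp
    qed
    also have "\<dots> = (\<integral>\<^sup>+X. \<integral>\<^sup>+y. ennreal (p g X y) * ennreal (G (W (D X y))) \<partial>?L \<partial>?P)"
    proof (rule nn_integral_cong)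
      fix X assume X: "X \<in> space ?P"
      have [measurable]: "(\<lambda>y. D X y) \<in> measurable ?L (PiM ?I (\<lambda>_. P \<Otimes>\<^sub>M lborel))"
        using measurable_Pair2[OF D X] by simp
      have m: "(\<lambda>y. ennreal (G (W (D X y)))) \<in> borel_measurable ?L"
        by measurable
      have "observed n g X \<xi> = D X (\<lambda>i\<in>?I. g (X i) + \<xi> i)" for \<xi>
        by (auto simp: observed_def D_def)
      then show "(\<integral>\<^sup>+\<xi>. ennreal (G (W (observed n g X \<xi>))) \<partial>PiM ?I (\<lambda>_. noise_law \<sigma>))
          = (\<integral>\<^sup>+y. ennreal (p g X y) * ennreal (G (W (D X y))) \<partial>?L)"
        unfolding p_def using nn_integral_noise_shift[OF \<sigma> _ m, of "\<lambda>i. g (X i)"] by simp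
    qed
    finally show ?thesis .
  qed
  have p_nonneg: "p g X y \<ge> 0" for g X y
    unfolding p_def by (intro prod_nonneg) auto
  have int_p: "(\<integral>\<^sup>+y. ennreal (p g X y) \<partial>?L) = 1" for g X
    unfolding p_def by (rule nn_integral_prod_normal[OF \<sigma>]) simp
  have e_nonneg: "e X \<ge> 0" for X
    unfolding e_def by (intro prod_nonneg) auto
  let ?A = "\<lambda>X y. ennreal (p f X y) * ennreal ((W (D X y) - \<kappa>)\<^sup>2) + ennreal (p f' X y) * ennreal ((W (D X y) + \<kappa>)\<^sup>2)"
  have inner: "ennreal (2 * \<kappa>\<^sup>2 * e X) \<le> (\<integral>\<^sup>+y. ?A X y \<partial>?L) + ennreal (\<kappa>\<^sup>2 / 2)"
    if X: "X \<in> space ?P" for X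
  proof -
    have [measurable]: "(\<lambda>y. D X y) \<in> measurable ?L (PiM ?I (\<lambda>_. P \<Otimes>\<^sub>M lborel))"
      using measurable_Pair2[OF D X] by simp
    have [measurable]: "(\<lambda>y. p g X y) \<in> borel_measurable ?L" for g
      unfolding p_def by measurable
    define c where "c = \<kappa>\<^sup>2 / 4"
    have c: "c \<ge> 0" by (simp add: c_def)
    \<comment> \<open>The midpoint regression function: \<open>p h X y * e X\<close> is the
      geometric mean of the two likelihoods, and the mass of \<open>p h X\<close> is 1.\<close>
    define h where "h x = (f x + f' x) / 2" for x
    have sq: "(p h X y * e X)\<^sup>2 = p f X y * p f' X y" for y
      unfolding p_def e_def h_def prod.distrib[symmetric] prod_power_distrib
      by (intro prod.cong refl normal_density_geometric_mean[OF \<sigma>])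
    have "ennreal (2 * \<kappa>\<^sup>2 * e X) = ennreal (2 * \<kappa>\<^sup>2 * e X) * (\<integral>\<^sup>+y. ennreal (p h X y) \<partial>?L)"
      by (simp add: int_p)
    also have "\<dots> = (\<integral>\<^sup>+y. ennreal (2 * \<kappa>\<^sup>2 * e X) * ennreal (p h X y) \<partial>?L)"
      by (rule nn_integral_cmult[symmetric]) measurable
    also have "\<dots> \<le> (\<integral>\<^sup>+y. ?A X y + ennreal c * (ennreal (p f X y) + ennreal (p f' X y)) \<partial>?L)"
    proof (rule nn_integral_mono)
      fix y
      have "2 * \<kappa>\<^sup>2 * (p h X y * e X) \<le> p f X y * (W (D X y) - \<kappa>)\<^sup>2 + p f' X y * (W (D X y) + \<kappa>)\<^sup>2
          + c * (p f X y + p f' X y)"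
        unfolding c_def by (rule two_point_pointwise) (auto simp: p_nonneg e_nonneg sq)
      then have "ennreal (2 * \<kappa>\<^sup>2 * e X * p h X y)
          \<le> ennreal (p f X y * (W (D X y) - \<kappa>)\<^sup>2 + p f' X y * (W (D X y) + \<kappa>)\<^sup>2 + c * (p f X y + p f' X y))"
        by (intro ennreal_leI) (simp add: mult_ac)
      then show "ennreal (2 * \<kappa>\<^sup>2 * e X) * ennreal (p h X y)
          \<le> ?A X y + ennreal c * (ennreal (p f X y) + ennreal (p f' X y))"
        by (simp add: ennreal_mult ennreal_plus p_nonneg e_nonneg c)
    qed
    also have "\<dots> = (\<integral>\<^sup>+y. ?A X y \<partial>?L) + ennreal c * (1 + 1)"
      by (subst nn_integral_add) (auto simp: nn_integral_cmult nn_integral_add int_p)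
    also have "ennreal c * (1 + 1) = ennreal (\<kappa>\<^sup>2 / 2)"
      unfolding c_def by (simp add: ennreal_mult'[symmetric] flip: ennreal_numeral)
    finally show ?thesis .
  qed
  \<comment> \<open>From exp (-z) >= 1 - z with z the sum of the (f - f')^2 / (8 \<sigma>^2) over
    the sample, whose mean is at most n \<delta> / (8 \<sigma>^2) <= 1/2. The bound is kept in
    additive form because \<open>ennreal\<close> subtraction truncates.\<close>
  have aff: "ennreal (1 / 2) \<le> (\<integral>\<^sup>+X. ennreal (e X) \<partial>?P)"
  proof -
    let ?z = "\<lambda>x. (f x - f' x)\<^sup>2 / (8 * \<sigma>\<^sup>2)"
    have "1 = (\<integral>\<^sup>+X. 1 \<partial>?P)" by (simp add: PP.emeasure_space_1)
    also have "\<dots> \<le> (\<integral>\<^sup>+X. ennreal (e X) + (\<Sum>i\<in>?I. ennreal (?z (X i))) \<partial>?P)"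
    proof (rule nn_integral_mono)
      fix X
      have "e X = exp (- (\<Sum>i\<in>?I. ?z (X i)))"
        unfolding e_def by (simp add: exp_sum sum_negf[symmetric])
      then have "1 \<le> e X + (\<Sum>i\<in>?I. ?z (X i))"
        using exp_ge_add_one_self[of "- (\<Sum>i\<in>?I. ?z (X i))"] by linarith
      then have "ennreal 1 \<le> ennreal (e X + (\<Sum>i\<in>?I. ?z (X i)))" by (rule ennreal_leI)
      then show "1 \<le> ennreal (e X) + (\<Sum>i\<in>?I. ennreal (?z (X i)))"
        by (simp add: ennreal_plus e_nonneg sum_nonneg sum_ennreal)
    qed
    also have "\<dots> = (\<integral>\<^sup>+X. ennreal (e X) \<partial>?P) + (\<Sum>i\<in>?I. \<integral>\<^sup>+X. ennreal (?z (X i)) \<partial>?P)"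
      by (subst nn_integral_add) (auto simp: nn_integral_sum simp del: sum_ennreal)
    also have "(\<Sum>i\<in>?I. \<integral>\<^sup>+X. ennreal (?z (X i)) \<partial>?P) \<le> (\<Sum>i\<in>?I. ennreal (\<delta> / (8 * \<sigma>\<^sup>2)))"
    proof (rule sum_mono)
      fix i assume i: "i \<in> ?I"
      have "(\<integral>\<^sup>+X. ennreal (?z (X i)) \<partial>?P) = (\<integral>\<^sup>+x. ennreal (?z x) \<partial>distr ?P P (\<lambda>X. X i))"
        using i by (intro nn_integral_distr[symmetric]) measurable
      also have "distr ?P P (\<lambda>X. X i) = P"
        using distr_PiM_component[of ?I "\<lambda>_. P" i] i P by simp
      also have "(\<integral>\<^sup>+x. ennreal (?z x) \<partial>P) = (\<integral>\<^sup>+x. ennreal ((f x - f' x)\<^sup>2) * ennreal (1 / (8 * \<sigma>\<^sup>2)) \<partial>P)"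
        by (intro nn_integral_cong) (simp add: ennreal_mult[symmetric])
      also have "\<dots> = (\<integral>\<^sup>+x. ennreal ((f x - f' x)\<^sup>2) \<partial>P) * ennreal (1 / (8 * \<sigma>\<^sup>2))"
        by (rule nn_integral_multc) measurable
      also have "\<dots> \<le> ennreal \<delta> * ennreal (1 / (8 * \<sigma>\<^sup>2))"
        using close by (intro mult_right_mono) auto
      also have "\<dots> = ennreal (\<delta> / (8 * \<sigma>\<^sup>2))"
        using close by (simp add: ennreal_mult[symmetric])
      finally show "(\<integral>\<^sup>+X. ennreal (?z (X i)) \<partial>?P) \<le> ennreal (\<delta> / (8 * \<sigma>\<^sup>2))" .
    qed
    also have "(\<Sum>i\<in>?I. ennreal (\<delta> / (8 * \<sigma>\<^sup>2))) = ennreal (real n * (\<delta> / (8 * \<sigma>\<^sup>2)))"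
    proof -
      have "(\<Sum>i\<in>?I. ennreal (\<delta> / (8 * \<sigma>\<^sup>2))) = ennreal (real n) * ennreal (\<delta> / (8 * \<sigma>\<^sup>2))"
        by (simp add: ennreal_of_nat_eq_real_of_nat)
      also have "\<dots> = ennreal (real n * (\<delta> / (8 * \<sigma>\<^sup>2)))"
        using close(3) by (intro ennreal_mult[symmetric]) auto
      finally show ?thesis .
    qed
    also have "\<dots> \<le> ennreal (1 / 2)"
      using close \<sigma> by (intro ennreal_leI) (simp add: field_simps)
    finally have *: "ennreal 1 \<le> (\<integral>\<^sup>+X. ennreal (e X) \<partial>?P) + ennreal (1 / 2)"
      by (simp add: add_left_mono)
    show ?thesis
      by (rule ennreal_le_add_cancel[where b = "1 / 2"]) (use * in auto)
  qed
  let ?R = "\<integral>\<^sup>+X. \<integral>\<^sup>+y. ?A X y \<partial>?L \<partial>?P"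
  have "ennreal (\<kappa>\<^sup>2) = ennreal (2 * \<kappa>\<^sup>2) * ennreal (1 / 2)"
    by (subst ennreal_mult[symmetric]) auto
  also have "\<dots> \<le> ennreal (2 * \<kappa>\<^sup>2) * (\<integral>\<^sup>+X. ennreal (e X) \<partial>?P)"
    by (intro mult_left_mono aff) auto
  also have "\<dots> = (\<integral>\<^sup>+X. ennreal (2 * \<kappa>\<^sup>2 * e X) \<partial>?P)"
    by (subst nn_integral_cmult[symmetric]) (auto simp: ennreal_mult e_nonneg)
  also have "\<dots> \<le> (\<integral>\<^sup>+X. (\<integral>\<^sup>+y. ?A X y \<partial>?L) + ennreal (\<kappa>\<^sup>2 / 2) \<partial>?P)"
    by (intro nn_integral_mono inner)
  also have "\<dots> = ?R + ennreal (\<kappa>\<^sup>2 / 2)"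
    by (subst nn_integral_add) (auto simp: PP.emeasure_space_1)
  finally have **: "ennreal (\<kappa>\<^sup>2) \<le> ?R + ennreal (\<kappa>\<^sup>2 / 2)" .
  have "ennreal (\<kappa>\<^sup>2 / 2) \<le> ?R"
    by (rule ennreal_le_add_cancel[where b = "\<kappa>\<^sup>2 / 2"]) (use ** in auto)
  also have "?R = (\<integral>\<^sup>+X. \<integral>\<^sup>+y. ennreal (p f X y) * ennreal ((W (D X y) - \<kappa>)\<^sup>2) \<partial>?L \<partial>?P)
      + (\<integral>\<^sup>+X. \<integral>\<^sup>+y. ennreal (p f' X y) * ennreal ((W (D X y) + \<kappa>)\<^sup>2) \<partial>?L \<partial>?P)"
  proof -
    have "?R = (\<integral>\<^sup>+X. (\<integral>\<^sup>+y. ennreal (p f X y) * ennreal ((W (D X y) - \<kappa>)\<^sup>2) \<partial>?L)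
      + (\<integral>\<^sup>+y. ennreal (p f' X y) * ennreal ((W (D X y) + \<kappa>)\<^sup>2) \<partial>?L) \<partial>?P)"
    proof (rule nn_integral_cong)
      fix X assume X: "X \<in> space ?P"
      have [measurable]: "(\<lambda>y. D X y) \<in> measurable ?L (PiM ?I (\<lambda>_. P \<Otimes>\<^sub>M lborel))"
        using measurable_Pair2[OF D X] by simp
      have [measurable]: "(\<lambda>y. p g X y) \<in> borel_measurable ?L" for g
        unfolding p_def by measurable
      show "(\<integral>\<^sup>+y. ?A X y \<partial>?L) = (\<integral>\<^sup>+y. ennreal (p f X y) * ennreal ((W (D X y) - \<kappa>)\<^sup>2) \<partial>?L)
        + (\<integral>\<^sup>+y. ennreal (p f' X y) * ennreal ((W (D X y) + \<kappa>)\<^sup>2) \<partial>?L)"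
        by (rule nn_integral_add) measurable
    qed
    then show ?thesis
      by (simp add: nn_integral_add)
  qed
  also have "\<dots> = (\<integral>\<^sup>+(X, \<xi>). ennreal ((W (observed n f X \<xi>) - \<kappa>)\<^sup>2) \<partial>S)
      + (\<integral>\<^sup>+(X, \<xi>). ennreal ((W (observed n f' X \<xi>) + \<kappa>)\<^sup>2) \<partial>S)"
    by (subst (1 2) change) auto
  finally show ?thesis .
qed

subsection \<open>Ensembles given by a density\<close>

text \<open>The supremum defining the upper variation of \<open>A\<close> is attained at the part of
  \<open>A\<close> where the density is nonnegative; the lower variation is the same fact for the
  negated density. \<open>M\<close> contributes only its sigma-algebra, which is why the reference
  measure \<open>Q\<close> is separate.\<close>

lemma
  assumes Q: "sets M = sets Q" and g: "integrable Q g"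
  defines "\<nu> \<equiv> \<lambda>A. LINT x:A|Q. g x"
  shows signed_measure_density: "signed_measure M \<nu>"
    and upper_variation_density: "upper_variation M \<nu> = density Q (\<lambda>x. ennreal (g x))"
    and lower_variation_density: "lower_variation M \<nu> = density Q (\<lambda>x. ennreal (- g x))"
proof -
  have space: "space M = space Q" by (rule sets_eq_imp_space_eq[OF Q])
  have si: "set_integrable Q A h" if "A \<in> sets Q" "integrable Q h" for A and h :: "'a \<Rightarrow> real"
    using that unfolding set_integrable_def by (rule integrable_mult_indicator)
  have sm: "signed_measure M (\<lambda>A. LINT x:A|Q. h x)" if h: "integrable Q h" for h :: "'a \<Rightarrow> real"
    unfolding signed_measure_def
  proof (intro conjI allI impI)
    fix A :: "nat \<Rightarrow> 'a set"
    assume A: "range A \<subseteq> sets M" "disjoint_family A"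
    then have AQ: "A i \<in> sets Q" for i using Q by auto
    have "(\<lambda>k. LINT x:(\<Union>i<k. A i)|Q. h x) \<longlonglongrightarrow> (LINT x:(\<Union>k. \<Union>i<k. A i)|Q. h x)"
      using AQ by (intro set_integral_cont_up si h) (fastforce simp: incseq_def)+
    moreover have "(\<Union>k. \<Union>i<k. A i) = (\<Union>i. A i)" by auto
    moreover have "(LINT x:(\<Union>i<k. A i)|Q. h x) = (\<Sum>i<k. LINT x:A i|Q. h x)" for k
      using A AQ by (intro set_integral_finite_Union si h) (auto simp: disjoint_family_on_def)
    ultimately show "(\<lambda>i. LINT x:A i|Q. h x) sums (LINT x:(\<Union>i. A i)|Q. h x)"
      by (simp add: sums_def)
  qed (simp add: set_lebesgue_integral_def)
  have uv: "upper_variation M (\<lambda>A. LINT x:A|Q. h x) = density Q (\<lambda>x. ennreal (h x))"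
    if h: "integrable Q h" for h :: "'a \<Rightarrow> real"
  proof (rule measure_eqI)
    show "sets (upper_variation M (\<lambda>A. LINT x:A|Q. h x)) = sets (density Q (\<lambda>x. ennreal (h x)))"
    proof -
      have "sets (upper_variation M (\<lambda>A. LINT x:A|Q. h x)) = sets M"
        unfolding upper_variation_def by (rule sets.sets_measure_of_eq)
      then show ?thesis using Q by simp
    qed
    fix A assume "A \<in> sets (upper_variation M (\<lambda>A. LINT x:A|Q. h x))"
    then have A: "A \<in> sets M" unfolding upper_variation_def by (simp only: sets.sets_measure_of_eq)
    then have AQ [measurable]: "A \<in> sets Q" using Q by simp
    have [measurable]: "h \<in> borel_measurable Q" using h by auto
    have "emeasure (density Q (\<lambda>x. ennreal (h x))) A = (\<integral>\<^sup>+x. ennreal (h x) * indicator A x \<partial>Q)"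
      by (rule emeasure_density) auto
    moreover have "(SUP B\<in>{B \<in> sets M. B \<subseteq> A}. ennreal (LINT x:B|Q. h x)) = (\<integral>\<^sup>+x. ennreal (h x) * indicator A x \<partial>Q)"
    proof (rule antisym)
      show "(SUP B\<in>{B \<in> sets M. B \<subseteq> A}. ennreal (LINT x:B|Q. h x)) \<le> (\<integral>\<^sup>+x. ennreal (h x) * indicator A x \<partial>Q)"
      proof (rule SUP_least)
        fix B assume B: "B \<in> {B \<in> sets M. B \<subseteq> A}"
        then have [measurable]: "B \<in> sets Q" using Q by auto
        have I: "integrable Q (\<lambda>x. max 0 (indicator B x *\<^sub>R h x))"
          using si[OF _ h, of B] by (simp add: set_integrable_def)
        have "ennreal (LINT x:B|Q. h x) \<le> ennreal (\<integral>x. max 0 (indicator B x *\<^sub>R h x) \<partial>Q)"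
          unfolding set_lebesgue_integral_def using si[OF _ h, of B] I
          by (intro ennreal_leI integral_mono) (auto simp: set_integrable_def)
        also have "\<dots> = (\<integral>\<^sup>+x. ennreal (max 0 (indicator B x *\<^sub>R h x)) \<partial>Q)"
          by (rule nn_integral_eq_integral[symmetric, OF I]) auto
        also have "\<dots> \<le> (\<integral>\<^sup>+x. ennreal (h x) * indicator A x \<partial>Q)"
          using B by (intro nn_integral_mono) (auto simp: max_def ennreal_neg split: split_indicator)
        finally show "ennreal (LINT x:B|Q. h x) \<le> (\<integral>\<^sup>+x. ennreal (h x) * indicator A x \<partial>Q)" .
      qed
      define B where "B = {x\<in>space Q. h x \<ge> 0} \<inter> A"
      have [measurable]: "B \<in> sets Q" unfolding B_def by measurable
      have "(\<integral>\<^sup>+x. ennreal (h x) * indicator A x \<partial>Q) = (\<integral>\<^sup>+x. ennreal (indicator B x *\<^sub>R h x) \<partial>Q)"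
        by (intro nn_integral_cong) (auto simp: B_def ennreal_neg split: split_indicator)
      also have "\<dots> = ennreal (LINT x:B|Q. h x)"
        unfolding set_lebesgue_integral_def using si[OF _ h, of B]
        by (intro nn_integral_eq_integral) (auto simp: set_integrable_def B_def split: split_indicator)
      also have "\<dots> \<le> (SUP B\<in>{B \<in> sets M. B \<subseteq> A}. ennreal (LINT x:B|Q. h x))"
        using Q by (intro SUP_upper) (auto simp: B_def)
      finally show "(\<integral>\<^sup>+x. ennreal (h x) * indicator A x \<partial>Q)
          \<le> (SUP B\<in>{B \<in> sets M. B \<subseteq> A}. ennreal (LINT x:B|Q. h x))" .
    qed
    ultimately show "emeasure (upper_variation M (\<lambda>A. LINT x:A|Q. h x)) A
        = emeasure (density Q (\<lambda>x. ennreal (h x))) A"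
      by (simp add: emeasure_upper_variation[OF sm[OF h] A])
  qed
  show "signed_measure M \<nu>" unfolding \<nu>_def by (rule sm[OF g])
  show "upper_variation M \<nu> = density Q (\<lambda>x. ennreal (g x))" unfolding \<nu>_def by (rule uv[OF g])
  have "(\<lambda>A. - \<nu> A) = (\<lambda>A. LINT x:A|Q. - g x)"
    unfolding \<nu>_def set_lebesgue_integral_def by simp
  then show "lower_variation M \<nu> = density Q (\<lambda>x. ennreal (- g x))"
    unfolding lower_variation_def using uv[of "\<lambda>x. - g x"] g by simp
qed

lemma tv_norm_density:
  assumes Q: "sets M = sets Q" and g: "integrable Q g"
  shows "tv_norm M (\<lambda>A. LINT x:A|Q. g x) = (\<integral>\<^sup>+x. ennreal \<bar>g x\<bar> \<partial>Q)"
proof -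
  have [measurable]: "g \<in> borel_measurable Q" using g by auto
  have [measurable]: "space M \<in> sets Q" using Q by (metis sets.top)
  have "tv_norm M (\<lambda>A. LINT x:A|Q. g x)
      = (\<integral>\<^sup>+x. ennreal (g x) * indicator (space M) x \<partial>Q) + (\<integral>\<^sup>+x. ennreal (- g x) * indicator (space M) x \<partial>Q)"
    unfolding tv_norm_def upper_variation_density[OF Q g] lower_variation_density[OF Q g]
    by (simp add: emeasure_density)
  also have "\<dots> = (\<integral>\<^sup>+x. ennreal (g x) * indicator (space M) x + ennreal (- g x) * indicator (space M) x \<partial>Q)"
    by (rule nn_integral_add[symmetric]) auto
  also have "\<dots> = (\<integral>\<^sup>+x. ennreal \<bar>g x\<bar> \<partial>Q)"
    using sets_eq_imp_space_eq[OF Q] by (intro nn_integral_cong) (auto simp: abs_if ennreal_neg)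
  finally show ?thesis .
qed

lemma signed_integral_density:
  assumes Q: "sets M = sets Q" and g: "integrable Q g"
    and f [measurable]: "f \<in> borel_measurable Q" and bound: "\<And>x. \<bar>f x\<bar> \<le> C"
  shows "signed_integral M (\<lambda>A. LINT x:A|Q. g x) f = (\<integral>x. f x * g x \<partial>Q)"
proof -
  have [measurable]: "g \<in> borel_measurable Q" using g by auto
  have C: "C \<ge> 0" using bound[of undefined] by linarith
  have I: "integrable Q (\<lambda>x. max 0 (h x) * f x)" if h: "integrable Q h" for h
  proof (rule Bochner_Integration.integrable_bound)
    show "integrable Q (\<lambda>x. C * h x)" using h by simp
    have [measurable]: "h \<in> borel_measurable Q" using h by auto
    show "(\<lambda>x. max 0 (h x) * f x) \<in> borel_measurable Q" by measurable
    show "AE x in Q. norm (max 0 (h x) * f x) \<le> norm (C * h x)"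
    proof (rule AE_I2)
      fix x
      have "\<bar>max 0 (h x)\<bar> * \<bar>f x\<bar> \<le> \<bar>h x\<bar> * C"
        using bound by (intro mult_mono) auto
      then show "norm (max 0 (h x) * f x) \<le> norm (C * h x)"
        using C by (simp add: abs_mult mult.commute)
    qed
  qed
  have d: "(\<integral>x. f x \<partial>density Q (\<lambda>x. ennreal (h x))) = (\<integral>x. max 0 (h x) * f x \<partial>Q)"
    if [measurable]: "h \<in> borel_measurable Q" for h :: "'a \<Rightarrow> real"
  proof -
    have "density Q (\<lambda>x. ennreal (h x)) = density Q (\<lambda>x. ennreal (max 0 (h x)))"
      by (intro density_cong AE_I2) (auto simp: max_def ennreal_neg)
    then show ?thesis by (simp only:) (subst integral_density, auto)
  qed
  have "signed_integral M (\<lambda>A. LINT x:A|Q. g x) f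
      = (\<integral>x. max 0 (g x) * f x \<partial>Q) - (\<integral>x. max 0 (- g x) * f x \<partial>Q)"
    unfolding signed_integral_def upper_variation_density[OF Q g] lower_variation_density[OF Q g]
    by (simp add: d)
  also have "\<dots> = (\<integral>x. max 0 (g x) * f x - max 0 (- g x) * f x \<partial>Q)"
    using g by (intro Bochner_Integration.integral_diff[symmetric] I) auto
  also have "\<dots> = (\<integral>x. f x * g x \<partial>Q)"
    by (intro Bochner_Integration.integral_cong) (auto simp: max_def)
  finally show ?thesis .
qed

lemma finite_index_pairs: "finite (index_pairs d s)"
  by (rule finite_subset[of _ "Pow {1..d} \<times> Pow {1..d}"]) (auto simp: index_pairs_def)

lemma measurable_basis_fun [measurable]: "(\<lambda>t. basis_fun L U t x) \<in> borel_measurable (thresholds L U)"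
proof -
  have [measurable]: "(\<lambda>t. t (Inl j)) \<in> borel_measurable (thresholds L U)" if "j \<in> L" for j
    unfolding thresholds_def using that by (intro measurable_component_singleton) auto
  have [measurable]: "(\<lambda>t. t (Inr j)) \<in> borel_measurable (thresholds L U)" if "j \<in> U" for j
    unfolding thresholds_def using that by (intro measurable_component_singleton) auto
  show ?thesis
    unfolding basis_fun_def by measurable
qed

lemma abs_basis_fun_le: "\<bar>basis_fun L U t x\<bar> \<le> 1"
proof -
  have "\<bar>\<Prod>j\<in>A. of_bool (P j)\<bar> \<le> (1::real)" for A and P :: "nat \<Rightarrow> bool"
    unfolding abs_prod by (rule prod_le_1) auto
  then show ?thesis
    unfolding basis_fun_def abs_mult by (intro mult_le_one) auto
qed

lemma sum_index_pairs_delta: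
  fixes c :: "'a :: comm_monoid_add"
  assumes "(L, U) \<in> index_pairs d s"
  shows "(\<Sum>(L', U')\<in>index_pairs d s. if L' = L \<and> U' = U then c else 0) = c"
proof -
  have "(\<Sum>(L', U')\<in>index_pairs d s. if L' = L \<and> U' = U then c else 0)
      = (\<Sum>z\<in>index_pairs d s. if z = (L, U) then c else 0)"
    by (intro sum.cong refl) (simp add: case_prod_beta' prod_eq_iff)
  then show ?thesis
    using assms by (simp add: finite_index_pairs)
qed

text \<open>One index pair carries all the mass, the constant is 0, and this single representation
  bounds the infimum in \<open>V_XGB\<close>. A lower bound on the minimax risk needs no other
  members of the class.\<close>

lemma F_ST_single_density:
  assumes LU: "(L, U) \<in> index_pairs d s" and Q: "sets (thresholds L U) = sets Q"
    and g: "integrable Q g" and V: "(\<integral>\<^sup>+t. ennreal \<bar>g t\<bar> \<partial>Q) \<le> ennreal V"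
    and f: "\<And>x. x \<in> space (Rd d) \<Longrightarrow> f x = (\<integral>t. basis_fun L U t x * g t \<partial>Q)"
  shows "f \<in> F_ST d s" "V_XGB d s f \<le> ennreal V"
proof -
  \<comment> \<open>The zero components are written as integrals over a null measure, so that the
    density lemmas also give their integrals and total variations.\<close>
  define \<nu> where "\<nu> L' U' = (if L' = L \<and> U' = U then (\<lambda>A. LINT t:A|Q. g t)
    else (\<lambda>A. LINT t:A|null_measure (thresholds L' U'). 0))" for L' U'
  have sm: "signed_measure (thresholds L' U') (\<nu> L' U')" for L' U'
    using signed_measure_density[OF Q g]
      signed_measure_density[of "thresholds L' U'" "null_measure (thresholds L' U')" "\<lambda>_. 0"]
    by (auto simp: \<nu>_def)
  have meas: "(\<lambda>t. basis_fun L U t x) \<in> borel_measurable Q" for x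
    using measurable_basis_fun measurable_cong_sets[OF Q refl] by blast
  have si: "signed_integral (thresholds L' U') (\<nu> L' U') (\<lambda>t. basis_fun L' U' t x)
      = (if L' = L \<and> U' = U then (\<integral>t. basis_fun L U t x * g t \<partial>Q) else 0)" for L' U' x
    using signed_integral_density[OF Q g meas abs_basis_fun_le]
      signed_integral_density[of "thresholds L' U'" "null_measure (thresholds L' U')" "\<lambda>_. 0",
        OF _ _ _ abs_basis_fun_le]
    by (auto simp: \<nu>_def)
  have tv: "tv_norm (thresholds L' U') (\<nu> L' U') = (if L' = L \<and> U' = U then (\<integral>\<^sup>+t. ennreal \<bar>g t\<bar> \<partial>Q) else 0)" for L' U'
    using tv_norm_density[OF Q g]
      tv_norm_density[of "thresholds L' U'" "null_measure (thresholds L' U')" "\<lambda>_. 0"]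
    by (auto simp: \<nu>_def)
  have rep: "represents d s 0 \<nu> f"
    unfolding represents_def signed_measure_family_def ensemble_fun_def si
    using f sm by (simp add: sum_index_pairs_delta[OF LU])
  then show "f \<in> F_ST d s" by (auto simp: F_ST_def)
  have "V_XGB d s f \<le> (\<Sum>(L', U')\<in>index_pairs d s. tv_norm (thresholds L' U') (\<nu> L' U'))"
    unfolding V_XGB_def using rep by (intro Inf_lower) auto
  also have "\<dots> = (\<integral>\<^sup>+t. ennreal \<bar>g t\<bar> \<partial>Q)"
    unfolding tv by (rule sum_index_pairs_delta[OF LU])
  finally show "V_XGB d s f \<le> ennreal V" using V by (rule order.trans)
qed

subsection \<open>Tensor products\<close>

text \<open>The missing coordinates are padded with the constant 1, whose integral over a
  probability space is 1. This lets functions of the first \<open>k\<close> coordinates be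
  integrated over the \<open>d\<close>-dimensional box.\<close>

lemma
  fixes F :: "'i \<Rightarrow> 'a \<Rightarrow> real"
  assumes fin: "finite I" and J: "J \<subseteq> I" and \<nu>: "\<And>i. prob_space (\<nu> i)"
    and F: "\<And>j. j \<in> J \<Longrightarrow> integrable (\<nu> j) (F j)"
  shows integrable_tensor: "integrable (PiM I \<nu>) (\<lambda>x. \<Prod>j\<in>J. F j (x j))"
    and integral_tensor: "(\<integral>x. (\<Prod>j\<in>J. F j (x j)) \<partial>PiM I \<nu>) = (\<Prod>j\<in>J. \<integral>x. F j x \<partial>\<nu> j)"
proof -
  interpret product_prob_space \<nu> by (intro product_prob_spaceI \<nu>)
  define G where "G i = (if i \<in> J then F i else (\<lambda>_. 1))" for i
  have eq: "(\<Prod>j\<in>J. F j (x j)) = (\<Prod>i\<in>I. G i (x i))" for x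
    using fin J by (intro prod.mono_neutral_cong_left) (auto simp: G_def)
  have G: "integrable (\<nu> i) (G i)" for i
    using F by (auto simp: G_def)
  show "integrable (PiM I \<nu>) (\<lambda>x. \<Prod>j\<in>J. F j (x j))"
    unfolding eq by (intro product_integrable_prod fin G)
  have "(\<Prod>j\<in>J. \<integral>x. F j x \<partial>\<nu> j) = (\<Prod>i\<in>I. \<integral>x. G i x \<partial>\<nu> i)"
    using fin J M.prob_space by (intro prod.mono_neutral_cong_left) (auto simp: G_def)
  then show "(\<integral>x. (\<Prod>j\<in>J. F j (x j)) \<partial>PiM I \<nu>) = (\<Prod>j\<in>J. \<integral>x. F j x \<partial>\<nu> j)"
    unfolding eq by (subst product_integral_prod[OF fin G]) simp
qed

declare One_nat_def [simp del]

section \<open>One-dimensional integrals under the uniform law\<close>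

lemma integrable_unif:
  fixes F :: "real \<Rightarrow> real"
  assumes M: "M > 0" and [measurable]: "F \<in> borel_measurable borel" and F: "\<And>x. \<bar>F x\<bar> \<le> C"
  shows "integrable (unif M) F"
proof -
  interpret prob_space "unif M" by (rule prob_space_unif[OF M])
  show ?thesis by (rule integrable_const_bound[where B = C]) (use F in auto)
qed

lemma abs_wave_le: "\<bar>wave m i x\<bar> \<le> 1"
proof -
  have "(wave m i x)\<^sup>2 \<le> 1"
    unfolding power2_eq_square wave_sq by (simp add: cell_def)
  then show ?thesis by (simp only: abs_square_le_1)
qed

lemma abs_bump_le: "\<bar>bump m i x\<bar> \<le> 1"
proof -
  have "(bump m i x)\<^sup>2 \<le> cell m i x / 4 ^ m" by (rule bump_sq_le)
  also have "\<dots> \<le> 1" by (simp add: cell_def)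
  finally show ?thesis by (simp add: abs_square_le_1)
qed

lemma haar_support: "i \<in> {0..<2 ^ m} \<Longrightarrow> y \<notin> {0..1} \<Longrightarrow> haar m i y = 0"
  using cell_support[of m i y] haar_mult_own_cell[of m i y] by auto

lemma wave_support:
  assumes "i \<in> {0..<2 ^ m}" "y \<notin> {0..1}"
  shows "wave m i y = 0"
proof -
  have "cell m i y = 0" using cell_support[of m i y] assms by blast
  then show ?thesis using wave_sq[of m i y] by simp
qed

lemma integral_unif_wave_wave:
  assumes "M > 0" "i \<in> {0..<2 ^ m}"
  shows "(\<integral>x. wave m i (std M x) * wave m' i' (std M x) \<partial>unif M) = (if m = m' \<and> i = i' then 1 / 2 ^ m else 0)"
  using integral_unif[OF assms(1), of "\<lambda>y. wave m i y * wave m' i' y"] wave_support[OF assms(2)]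
  by (simp add: integral_wave_wave)

lemma integral_unif_haar_haar:
  assumes "M > 0" "i \<in> {0..<2 ^ m}"
  shows "(\<integral>x. haar m i (std M x) * haar m' i' (std M x) \<partial>unif M) = (if m = m' \<and> i = i' then 1 / 2 ^ m else 0)"
  using integral_unif[OF assms(1), of "\<lambda>y. haar m i y * haar m' i' y"] haar_support[OF assms(2)]
  by (simp add: integral_haar_haar)

lemma integral_unif_bump_haar:
  assumes "M > 0" "i' \<in> {0..<2 ^ m'}" "m' < m \<or> m' = m"
  shows "(\<integral>x. bump m i (std M x) * haar m' i' (std M x) \<partial>unif M) = (if m' = m \<and> i' = i then 1 / (8 * 4 ^ m) else 0)"
  using integral_unif[OF assms(1), of "\<lambda>y. bump m i y * haar m' i' y"] haar_support[OF assms(2)]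
  by (simp add: integral_bump_haar[OF assms(3)])

lemma integral_unif_wave_le:
  assumes "M > 0" "i \<in> {0..<2 ^ m}"
  shows "(\<integral>t. of_bool (t \<le> x) * wave m i (std M t) \<partial>unif M) = bump m i (std M x)"
  using integral_unif[OF assms(1), of "\<lambda>y. of_bool (y \<le> std M x) * wave m i y"] wave_support[OF assms(2)]
  by (simp add: integral_wave_le std_le_iff[OF assms(1)])

lemma integral_unif_bump_sq_le:
  assumes M: "M > 0" and i: "i \<in> {0..<2 ^ m}"
  shows "(\<integral>x. (bump m i (std M x))\<^sup>2 \<partial>unif M) \<le> 1 / 8 ^ m"
proof -
  have "(\<integral>x. (bump m i (std M x))\<^sup>2 \<partial>unif M) \<le> (\<integral>x. cell m i (std M x) / 4 ^ m \<partial>unif M)"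
  proof (intro integral_mono bump_sq_le)
    show "integrable (unif M) (\<lambda>x. (bump m i (std M x))\<^sup>2)"
      by (rule integrable_unif[OF M, where C = 1]) (auto simp: abs_square_le_1 abs_bump_le)
    show "integrable (unif M) (\<lambda>x. cell m i (std M x) / 4 ^ m)"
      by (rule integrable_unif[OF M, where C = 1]) (auto simp: cell_def)
  qed
  also have "\<dots> = 1 / 8 ^ m"
  proof -
    have "(\<lambda>y. cell m i y / 4 ^ m) \<in> borel_measurable borel" "y \<notin> {0..1} \<Longrightarrow> cell m i y / 4 ^ m = 0" for y
      using cell_support[OF _ i] by auto
    from integral_unif[OF M this] have "(\<integral>x. cell m i (std M x) / 4 ^ m \<partial>unif M) = 1 / 2 ^ m / 4 ^ m"
      by (simp add: integral_cell)
    also have "\<dots> = 1 / 8 ^ m"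
      using power_mult_distrib[of "2::real" 4 m] by simp
    finally show ?thesis .
  qed
  finally show ?thesis .
qed

section \<open>Products over dyadic boxes\<close>

definition box_law :: "nat \<Rightarrow> (nat \<Rightarrow> real) \<Rightarrow> (nat \<Rightarrow> real) measure" where
  "box_law d M = PiM {1..d} (\<lambda>j. unif (M j))"

type_synonym dyadic = "(nat \<Rightarrow> nat) \<times> (nat \<Rightarrow> int)"

text \<open>A box is given by its scales and its position; fixing the sum of the scales fixes the
  volume at 2^-l. Extensionality makes different elements differ in a coordinate from
  \<open>{1..k}\<close>, without which distinct labels could denote the same function.\<close>

definition dyadics :: "nat \<Rightarrow> nat \<Rightarrow> dyadic set" where
  "dyadics k l = {(m, i). m \<in> extensional {1..k} \<and> (\<Sum>j=1..k. m j) = l \<and> i \<in> PiE {1..k} (\<lambda>j. {0..<2 ^ m j})}"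

definition bumps :: "nat \<Rightarrow> (nat \<Rightarrow> real) \<Rightarrow> dyadic \<Rightarrow> (nat \<Rightarrow> real) \<Rightarrow> real" where
  "bumps k M s x = (\<Prod>j=1..k. bump (fst s j) (snd s j) (std (M j) (x j)))"

definition haars :: "nat \<Rightarrow> (nat \<Rightarrow> real) \<Rightarrow> dyadic \<Rightarrow> (nat \<Rightarrow> real) \<Rightarrow> real" where
  "haars k M s x = (\<Prod>j=1..k. haar (fst s j) (snd s j) (std (M j) (x j)))"

definition waves :: "nat \<Rightarrow> (nat \<Rightarrow> real) \<Rightarrow> dyadic \<Rightarrow> (nat + nat \<Rightarrow> real) \<Rightarrow> real" where
  "waves k M s t = (\<Prod>j=1..k. wave (fst s j) (snd s j) (std (M j) (t (Inl j))))"

text \<open>Indexed by \<open>{1..k} <+> {}\<close> to share the sigma-algebra of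
  \<open>thresholds {1..k} {}\<close>: only lower thresholds are used, and \<open>projl\<close>
  recovers the coordinate.\<close>

definition threshold_law :: "nat \<Rightarrow> (nat \<Rightarrow> real) \<Rightarrow> (nat + nat \<Rightarrow> real) measure" where
  "threshold_law k M = PiM ({1..k} <+> {}) (\<lambda>a. unif (M (projl a)))"

lemma dyadics_index: "s \<in> dyadics k l \<Longrightarrow> j \<in> {1..k} \<Longrightarrow> snd s j \<in> {0..<2 ^ fst s j}"
  by (auto simp: dyadics_def)

lemma dyadics_sum: "s \<in> dyadics k l \<Longrightarrow> (\<Sum>j=1..k. fst s j) = l"
  by (auto simp: dyadics_def)

lemma dyadics_neq:
  assumes "s \<in> dyadics k l" "s' \<in> dyadics k l" "s \<noteq> s'"
  shows "\<exists>j\<in>{1..k}. fst s j \<noteq> fst s' j \<or> snd s j \<noteq> snd s' j"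
proof (rule ccontr)
  assume "\<not> ?thesis"
  then have eq: "fst s j = fst s' j" "snd s j = snd s' j" if "j \<in> {1..k}" for j
    using that by blast+
  have ext: "fst z \<in> extensional {1..k}" "snd z \<in> extensional {1..k}" if "z \<in> dyadics k l" for z
    using that by (auto simp: dyadics_def PiE_iff)
  have "fst s = fst s'"
    by (rule extensionalityI[OF ext(1)[OF assms(1)] ext(1)[OF assms(2)] eq(1)])
  moreover have "snd s = snd s'"
    by (rule extensionalityI[OF ext(2)[OF assms(1)] ext(2)[OF assms(2)] eq(2)])
  ultimately  show False using assms(3) by (simp add: prod_eq_iff)
qed

text \<open>If \<open>s'\<close> were strictly coarser than \<open>s\<close> in no coordinate, the
  equal sums would force equal scales throughout, and then the positions must differ
  somewhere.\<close>

lemma dyadics_coarser: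
  assumes "s \<in> dyadics k l" "s' \<in> dyadics k l" "s \<noteq> s'"
  shows "\<exists>j\<in>{1..k}. fst s' j < fst s j \<or> fst s' j = fst s j \<and> snd s' j \<noteq> snd s j"
proof (rule ccontr)
  assume *: "\<not> ?thesis"
  then have le: "\<forall>j\<in>{1..k}. fst s j \<le> fst s' j" by auto
  have "\<not> (\<exists>j\<in>{1..k}. fst s j < fst s' j)"
    using sum_strict_mono_ex1[of "{1..k}" "fst s" "fst s'"] le dyadics_sum[OF assms(1)] dyadics_sum[OF assms(2)]
    by auto
  then have "\<forall>j\<in>{1..k}. fst s j = fst s' j" using le by (meson le_neq_implies_less)
  then show False using * dyadics_neq[OF assms] by metis
qed

lemma sets_threshold_law: "sets (thresholds {1..k} {}) = sets (threshold_law k M)"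
  unfolding thresholds_def threshold_law_def by (intro sets_PiM_cong) auto

lemma sets_box_law: "sets (box_law d M) = sets (Rd d)"
  unfolding Rd_def box_law_def by (intro sets_PiM_cong) auto

context
  fixes M :: "nat \<Rightarrow> real" and k l :: nat
  assumes M: "\<And>j. M j > 0"
begin

lemma prob_space_box_law: "prob_space (box_law d M)"
  unfolding box_law_def by (intro prob_space_PiM prob_space_unif M)

lemma prob_space_threshold_law: "prob_space (threshold_law k M)"
  unfolding threshold_law_def by (intro prob_space_PiM prob_space_unif M)

lemma integral_box_law:
  fixes F :: "nat \<Rightarrow> real \<Rightarrow> real"
  assumes kd: "k \<le> d" and [measurable]: "\<And>j. F j \<in> borel_measurable borel" and F: "\<And>j x. \<bar>F j x\<bar> \<le> 1"
  shows "(\<integral>x. (\<Prod>j=1..k. F j (x j)) \<partial>box_law d M) = (\<Prod>j=1..k. \<integral>x. F j x \<partial>unif (M j))"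
  unfolding box_law_def using kd
  by (intro integral_tensor prob_space_unif M integrable_unif[OF M _ F]) auto

lemma
  fixes F :: "nat \<Rightarrow> real \<Rightarrow> real"
  assumes [measurable]: "\<And>j. F j \<in> borel_measurable borel" and F: "\<And>j x. \<bar>F j x\<bar> \<le> 1"
  shows integrable_threshold_law: "integrable (threshold_law k M) (\<lambda>t. \<Prod>j=1..k. F j (t (Inl j)))"
    and integral_threshold_law: "(\<integral>t. (\<Prod>j=1..k. F j (t (Inl j))) \<partial>threshold_law k M) = (\<Prod>j=1..k. \<integral>x. F j x \<partial>unif (M j))"
proof -
  have eq: "(\<Prod>j=1..k. F j (t (Inl j))) = (\<Prod>a\<in>{1..k} <+> {}. F (projl a) (t a))" for t :: "nat + nat \<Rightarrow> real"
    by (subst prod.Plus) auto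
  have eq': "(\<Prod>j=1..k. \<integral>x. F j x \<partial>unif (M j)) = (\<Prod>a\<in>{1..k} <+> ({} :: nat set). \<integral>x. F (projl a) x \<partial>unif (M (projl a)))"
    by (subst prod.Plus) auto
  show "integrable (threshold_law k M) (\<lambda>t. \<Prod>j=1..k. F j (t (Inl j)))"
    unfolding eq threshold_law_def
    by (intro integrable_tensor prob_space_unif M integrable_unif[OF M _ F]) auto
  show "(\<integral>t. (\<Prod>j=1..k. F j (t (Inl j))) \<partial>threshold_law k M) = (\<Prod>j=1..k. \<integral>x. F j x \<partial>unif (M j))"
  proof -
    have "(\<integral>t. (\<Prod>j=1..k. F j (t (Inl j))) \<partial>threshold_law k M)
        = (\<Prod>a\<in>{1..k} <+> ({} :: nat set). \<integral>x. F (projl a) x \<partial>unif (M (projl a)))"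
      unfolding eq threshold_law_def
      by (rule integral_tensor[where F = "\<lambda>a. F (projl a)"])
        (auto intro!: prob_space_unif M integrable_unif[OF M _ F])
    then show ?thesis using eq' by simp
  qed
qed

lemma abs_bumps_le: "\<bar>bumps k M s x\<bar> \<le> 1"
  unfolding bumps_def abs_prod by (intro prod_le_1) (auto simp: abs_bump_le)

lemma abs_haars_le: "\<bar>haars k M s x\<bar> \<le> 1"
  unfolding haars_def abs_prod by (intro prod_le_1) (auto simp: abs_haar_le)

lemma measurable_bumps:
  assumes "k \<le> d"
  shows "bumps k M s \<in> borel_measurable (Rd d)"
proof -
  have [measurable]: "(\<lambda>x. x j) \<in> borel_measurable (Rd d)" if "j \<in> {1..k}" for j
    using measurable_component_singleton[of j "{1..d}" "\<lambda>_. lborel"] assms that by (simp add: Rd_def)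
  show ?thesis unfolding bumps_def by measurable
qed

lemma measurable_haars:
  assumes "k \<le> d"
  shows "haars k M s \<in> borel_measurable (Rd d)"
proof -
  have [measurable]: "(\<lambda>x. x j) \<in> borel_measurable (Rd d)" if "j \<in> {1..k}" for j
    using measurable_component_singleton[of j "{1..d}" "\<lambda>_. lborel"] assms that by (simp add: Rd_def)
  show ?thesis unfolding haars_def by measurable
qed

text \<open>For distinct boxes the coordinate from \<open>dyadics_coarser\<close> contributes a
  vanishing factor. On the diagonal the factors 1 / (8 * 4^(m j)) multiply to a value that depends
  on the volume but not on the shape.\<close>

lemma integral_bumps_haars:
  assumes kd: "k \<le> d" and s: "s \<in> dyadics k l" "s' \<in> dyadics k l"
  shows "(\<integral>x. bumps k M s x * haars k M s' x \<partial>box_law d M) = (if s = s' then 1 / (8 ^ k * 4 ^ l) else 0)"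
proof -
  have "(\<integral>x. bumps k M s x * haars k M s' x \<partial>box_law d M)
     = (\<Prod>j=1..k. \<integral>y. bump (fst s j) (snd s j) (std (M j) y) * haar (fst s' j) (snd s' j) (std (M j) y) \<partial>unif (M j))"
    unfolding bumps_def haars_def prod.distrib[symmetric] using kd
    by (subst integral_box_law) (auto simp: abs_mult intro!: mult_le_one abs_haar_le abs_bump_le)
  also have "\<dots> = (if s = s' then 1 / (8 ^ k * 4 ^ l) else 0)"
  proof (cases "s = s'")
    case True
    then have "(\<Prod>j=1..k. \<integral>y. bump (fst s j) (snd s j) (std (M j) y) * haar (fst s' j) (snd s' j) (std (M j) y) \<partial>unif (M j))
        = (\<Prod>j=1..k. 1 / (8 * 4 ^ fst s j))"
      using dyadics_index[OF s(2)] by (intro prod.cong refl) (subst integral_unif_bump_haar, auto simp: M)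
    also have "\<dots> = 1 / (8 ^ k * 4 ^ l)"
      by (simp add: prod_dividef prod.distrib power_sum[symmetric] dyadics_sum[OF s(1)])
    finally show ?thesis using True by simp
  next
    case False
    then obtain j where j: "j \<in> {1..k}" "fst s' j < fst s j \<or> fst s' j = fst s j \<and> snd s' j \<noteq> snd s j"
      using dyadics_coarser[OF s] by auto
    then have "(\<integral>y. bump (fst s j) (snd s j) (std (M j) y) * haar (fst s' j) (snd s' j) (std (M j) y) \<partial>unif (M j)) = 0"
      using dyadics_index[OF s(2)] by (subst integral_unif_bump_haar) (auto simp: M)
    then have "(\<Prod>j=1..k. \<integral>y. bump (fst s j) (snd s j) (std (M j) y) * haar (fst s' j) (snd s' j) (std (M j) y) \<partial>unif (M j)) = 0"
      using j(1) by (intro prod_zero) auto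
    then show ?thesis using False by simp
  qed
  finally show ?thesis .
qed

lemma integral_haars_haars:
  assumes kd: "k \<le> d" and s: "s \<in> dyadics k l" "s' \<in> dyadics k l"
  shows "(\<integral>x. haars k M s x * haars k M s' x \<partial>box_law d M) = (if s = s' then 1 / 2 ^ l else 0)"
proof -
  have "(\<integral>x. haars k M s x * haars k M s' x \<partial>box_law d M)
     = (\<Prod>j=1..k. \<integral>y. haar (fst s j) (snd s j) (std (M j) y) * haar (fst s' j) (snd s' j) (std (M j) y) \<partial>unif (M j))"
    unfolding haars_def prod.distrib[symmetric] using kd
    by (subst integral_box_law) (auto simp: abs_mult intro!: mult_le_one abs_haar_le)
  also have "\<dots> = (\<Prod>j=1..k. if fst s j = fst s' j \<and> snd s j = snd s' j then 1 / 2 ^ fst s j else 0)"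
    using dyadics_index[OF s(1)] by (intro prod.cong refl) (subst integral_unif_haar_haar, auto simp: M)
  also have "\<dots> = (if s = s' then 1 / 2 ^ l else 0)"
    using dyadics_neq[OF s] dyadics_sum[OF s(1)]
    by (auto simp: prod_dividef power_sum[symmetric] intro!: prod_zero)
  finally show ?thesis .
qed

lemma integral_waves_waves:
  assumes s: "s \<in> dyadics k l" "s' \<in> dyadics k l"
  shows "(\<integral>t. waves k M s t * waves k M s' t \<partial>threshold_law k M) = (if s = s' then 1 / 2 ^ l else 0)"
proof -
  have "(\<integral>t. waves k M s t * waves k M s' t \<partial>threshold_law k M)
     = (\<Prod>j=1..k. \<integral>y. wave (fst s j) (snd s j) (std (M j) y) * wave (fst s' j) (snd s' j) (std (M j) y) \<partial>unif (M j))"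
    unfolding waves_def prod.distrib[symmetric]
    by (subst integral_threshold_law[where F = "\<lambda>j y. wave (fst s j) (snd s j) (std (M j) y) * wave (fst s' j) (snd s' j) (std (M j) y)"])
      (auto simp: abs_mult intro!: mult_le_one abs_wave_le)
  also have "\<dots> = (\<Prod>j=1..k. if fst s j = fst s' j \<and> snd s j = snd s' j then 1 / 2 ^ fst s j else 0)"
    using dyadics_index[OF s(1)] by (intro prod.cong refl) (subst integral_unif_wave_wave, auto simp: M)
  also have "\<dots> = (if s = s' then 1 / 2 ^ l else 0)"
    using dyadics_neq[OF s] dyadics_sum[OF s(1)]
    by (auto simp: prod_dividef power_sum[symmetric] intro!: prod_zero)
  finally show ?thesis .
qed

lemma integrable_waves_waves: "integrable (threshold_law k M) (\<lambda>t. waves k M s t * waves k M s' t)"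
  unfolding waves_def prod.distrib[symmetric]
  by (rule integrable_threshold_law[where F = "\<lambda>j y. wave (fst s j) (snd s j) (std (M j) y) * wave (fst s' j) (snd s' j) (std (M j) y)"])
     (auto simp: abs_mult intro!: mult_le_one abs_wave_le)

lemma integrable_waves: "integrable (threshold_law k M) (waves k M s)"
  unfolding waves_def
  by (rule integrable_threshold_law[where F = "\<lambda>j y. wave (fst s j) (snd s j) (std (M j) y)"]) (auto intro: abs_wave_le)

lemma integral_bumps_sq_le:
  assumes kd: "k \<le> d" and s: "s \<in> dyadics k l"
  shows "(\<integral>x. (bumps k M s x)\<^sup>2 \<partial>box_law d M) \<le> 1 / 8 ^ l"
proof -
  have "(\<integral>x. (bumps k M s x)\<^sup>2 \<partial>box_law d M)
      = (\<Prod>j=1..k. \<integral>y. (bump (fst s j) (snd s j) (std (M j) y))\<^sup>2 \<partial>unif (M j))"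
    unfolding bumps_def prod_power_distrib using kd
    by (subst integral_box_law) (auto simp: abs_square_le_1 abs_bump_le)
  also have "\<dots> \<le> (\<Prod>j=1..k. 1 / 8 ^ fst s j)"
    using dyadics_index[OF s] by (intro prod_mono conjI integral_unif_bump_sq_le M integral_nonneg_AE) auto
  also have "\<dots> = 1 / 8 ^ l"
    by (simp add: prod_dividef power_sum[symmetric] dyadics_sum[OF s])
  finally show ?thesis .
qed

text \<open>With no upper thresholds the basis function is a product of the factors t_j <= x_j, so
  the integral splits into primitives of waves.\<close>

lemma basis_fun_waves:
  assumes s: "s \<in> dyadics k l"
  shows "integrable (threshold_law k M) (\<lambda>t. basis_fun {1..k} {} t x * waves k M s t)"
    and "(\<integral>t. basis_fun {1..k} {} t x * waves k M s t \<partial>threshold_law k M) = bumps k M s x"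
proof -
  let ?F = "\<lambda>j y. of_bool (y \<le> x j) * wave (fst s j) (snd s j) (std (M j) y)"
  have F: "?F j \<in> borel_measurable borel" "\<bar>?F j y\<bar> \<le> 1" for j y
    using abs_wave_le by (auto simp: abs_mult)
  have eq: "basis_fun {1..k} {} t x * waves k M s t = (\<Prod>j=1..k. ?F j (t (Inl j)))" for t
    unfolding basis_fun_def waves_def prod.distrib by simp
  show "integrable (threshold_law k M) (\<lambda>t. basis_fun {1..k} {} t x * waves k M s t)"
    unfolding eq by (rule integrable_threshold_law[of ?F, OF F])
  have "(\<integral>t. basis_fun {1..k} {} t x * waves k M s t \<partial>threshold_law k M) = (\<Prod>j=1..k. \<integral>y. ?F j y \<partial>unif (M j))"
    unfolding eq by (rule integral_threshold_law[of ?F, OF F])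
  also have "\<dots> = bumps k M s x"
    unfolding bumps_def using dyadics_index[OF s] by (intro prod.cong refl integral_unif_wave_le M) auto
  finally show "(\<integral>t. basis_fun {1..k} {} t x * waves k M s t \<partial>threshold_law k M) = bumps k M s x" .
qed

lemma bump_sum_in_class:
  assumes k: "1 \<le> k" "k \<le> d" "k \<le> r" and S: "finite S" "S \<subseteq> dyadics k l"
    and V: "V > 0" and c: "(\<Sum>s\<in>S. (c s)\<^sup>2) / 2 ^ l \<le> V\<^sup>2"
  defines "f \<equiv> \<lambda>x. \<Sum>s\<in>S. c s * bumps k M s x"
  shows "f \<in> F_ST d r" "V_XGB d r f \<le> ennreal V"
proof -
  let ?Q = "threshold_law k M"
  interpret Q: prob_space ?Q by (rule prob_space_threshold_law)
  define g where "g t = (\<Sum>s\<in>S. c s * waves k M s t)" for t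
  have g: "integrable ?Q g"
    unfolding g_def by (intro Bochner_Integration.integrable_sum integrable_mult_right integrable_waves)
  have g_sq: "(g t)\<^sup>2 = (\<Sum>s\<in>S. \<Sum>s'\<in>S. c s * c s' * (waves k M s t * waves k M s' t))" for t
    unfolding g_def power2_eq_square sum_product by (simp add: mult_ac)
  have g2: "integrable ?Q (\<lambda>t. (g t)\<^sup>2)"
    unfolding g_sq by (intro Bochner_Integration.integrable_sum integrable_mult_right integrable_waves_waves)
  have "(\<integral>t. (g t)\<^sup>2 \<partial>?Q) = (\<Sum>s\<in>S. \<Sum>s'\<in>S. c s * c s' * (if s = s' then 1 / 2 ^ l else 0))"
    unfolding g_sq using S(2)
    by (subst Bochner_Integration.integral_sum, intro Bochner_Integration.integrable_sum integrable_mult_right integrable_waves_waves)+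
      (intro sum.cong refl, subst integral_mult_right_zero, subst integral_waves_waves, auto)
  also have "\<dots> = (\<Sum>s\<in>S. (c s)\<^sup>2) / 2 ^ l"
    using S(1) by (simp add: if_distrib sum.delta power2_eq_square sum_divide_distrib cong: if_cong)
  finally have L2: "(\<integral>t. (g t)\<^sup>2 \<partial>?Q) \<le> V\<^sup>2" using c by simp
  \<comment> \<open>AM-GM takes the place of Cauchy-Schwarz: since the integral of g^2 is at most
    V^2 and the threshold law is a probability, both terms contribute at most V / 2.\<close>
  have "(\<integral>t. \<bar>g t\<bar> \<partial>?Q) \<le> (\<integral>t. (g t)\<^sup>2 / (2 * V) + V / 2 \<partial>?Q)"
  proof (intro integral_mono)
    fix t
    have "0 \<le> (\<bar>g t\<bar> - V)\<^sup>2" by simp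
    then show "\<bar>g t\<bar> \<le> (g t)\<^sup>2 / (2 * V) + V / 2"
      using V by (simp add: power2_eq_square field_simps)
  qed (use g g2 in auto)
  also have "\<dots> = (\<integral>t. (g t)\<^sup>2 \<partial>?Q) / (2 * V) + V / 2"
    using g2 Q.prob_space by simp
  also have "\<dots> \<le> V\<^sup>2 / (2 * V) + V / 2"
    using L2 V by (intro add_right_mono divide_right_mono) auto
  also have "\<dots> = V" using V by (simp add: power2_eq_square)
  finally have L1: "(\<integral>\<^sup>+t. ennreal \<bar>g t\<bar> \<partial>?Q) \<le> ennreal V"
    using g by (subst nn_integral_eq_integral) (auto intro: ennreal_leI)
  have LU: "({1..k}, {}) \<in> index_pairs d r"
    using k by (auto simp: index_pairs_def)
  have rep: "f x = (\<integral>t. basis_fun {1..k} {} t x * g t \<partial>?Q)" for x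
  proof -
    have "(\<integral>t. basis_fun {1..k} {} t x * g t \<partial>?Q)
        = (\<integral>t. (\<Sum>s\<in>S. c s * (basis_fun {1..k} {} t x * waves k M s t)) \<partial>?Q)"
      unfolding g_def sum_distrib_left by (simp add: mult_ac)
    also have "\<dots> = (\<Sum>s\<in>S. c s * bumps k M s x)"
      using basis_fun_waves[OF subsetD[OF S(2)]]
      by (subst Bochner_Integration.integral_sum) (auto intro!: sum.cong)
    finally show ?thesis by (simp add: f_def)
  qed
  show "f \<in> F_ST d r" "V_XGB d r f \<le> ennreal V"
    by (rule F_ST_single_density[OF LU sets_threshold_law g L1 rep])+
qed

end

subsection \<open>From the risk to single coefficients\<close>

text \<open>The system is orthogonal with common squared norm \<open>h\<close>, not normalized; the
  proof integrates the square of \<open>g\<close> minus its projection.\<close>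

lemma bessel_inequality:
  fixes g :: "'a \<Rightarrow> real"
  assumes Q: "prob_space Q" and S: "finite S" and h: "h > 0"
    and H: "\<And>s. s \<in> S \<Longrightarrow> H s \<in> borel_measurable Q" "\<And>s x. s \<in> S \<Longrightarrow> \<bar>H s x\<bar> \<le> 1"
    and orth: "\<And>s t. s \<in> S \<Longrightarrow> t \<in> S \<Longrightarrow> (\<integral>x. H s x * H t x \<partial>Q) = (if s = t then h else 0)"
    and g [measurable]: "g \<in> borel_measurable Q" and g2: "integrable Q (\<lambda>x. (g x)\<^sup>2)"
  shows "\<And>s. s \<in> S \<Longrightarrow> integrable Q (\<lambda>x. g x * H s x)"
    and "(\<Sum>s\<in>S. (\<integral>x. g x * H s x \<partial>Q)\<^sup>2) / h \<le> (\<integral>x. (g x)\<^sup>2 \<partial>Q)"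
proof -
  interpret prob_space Q by (rule Q)
  note H(1) [measurable]
  show I: "integrable Q (\<lambda>x. g x * H s x)" if s: "s \<in> S" for s
  proof (rule Bochner_Integration.integrable_bound)
    show "integrable Q (\<lambda>x. (g x)\<^sup>2 + 1)" using g2 by simp
    show "(\<lambda>x. g x * H s x) \<in> borel_measurable Q" using s by measurable
    show "AE x in Q. norm (g x * H s x) \<le> norm ((g x)\<^sup>2 + 1)"
    proof (rule AE_I2)
      fix x
      have "0 \<le> (\<bar>g x\<bar> - 1)\<^sup>2" by simp
      then have "\<bar>g x\<bar> \<le> (g x)\<^sup>2 + 1" by (simp add: power2_eq_square algebra_simps)
      moreover have "\<bar>g x\<bar> * \<bar>H s x\<bar> \<le> \<bar>g x\<bar> * 1" using H(2)[OF s] by (intro mult_left_mono) auto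
      ultimately show "norm (g x * H s x) \<le> norm ((g x)\<^sup>2 + 1)" by (simp add: abs_mult)
    qed
  qed
  have HH: "integrable Q (\<lambda>x. H s x * H t x)" if "s \<in> S" "t \<in> S" for s t
    using H(2)[OF that(1)] H(2)[OF that(2)] that
    by (intro integrable_const_bound[where B = 1]) (auto simp: abs_mult intro!: mult_le_one)
  define c where "c s = (\<integral>x. g x * H s x \<partial>Q) / h" for s
  have eq: "(g x - (\<Sum>s\<in>S. c s * H s x))\<^sup>2
      = (g x)\<^sup>2 - 2 * (\<Sum>s\<in>S. c s * (g x * H s x)) + (\<Sum>s\<in>S. \<Sum>t\<in>S. c s * c t * (H s x * H t x))" for x
    by (simp add: power2_diff sum_distrib_left sum_product power2_eq_square[of "sum _ _"] mult_ac)
  have "0 \<le> (\<integral>x. (g x - (\<Sum>s\<in>S. c s * H s x))\<^sup>2 \<partial>Q)"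
    by (intro integral_nonneg_AE) auto
  also have "\<dots> = (\<integral>x. (g x)\<^sup>2 \<partial>Q) - 2 * (\<Sum>s\<in>S. c s * (\<integral>x. g x * H s x \<partial>Q))
      + (\<Sum>s\<in>S. \<Sum>t\<in>S. c s * c t * (\<integral>x. H s x * H t x \<partial>Q))"
    unfolding eq using g2 I HH
    by (simp add: Bochner_Integration.integral_add Bochner_Integration.integral_diff Bochner_Integration.integral_sum
        Bochner_Integration.integrable_sum Bochner_Integration.integrable_diff)
  also have "(\<Sum>s\<in>S. \<Sum>t\<in>S. c s * c t * (\<integral>x. H s x * H t x \<partial>Q)) = (\<Sum>s\<in>S. (\<integral>x. g x * H s x \<partial>Q)\<^sup>2) / h"
  proof -
    have "(\<Sum>s\<in>S. \<Sum>t\<in>S. c s * c t * (\<integral>x. H s x * H t x \<partial>Q))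
        = (\<Sum>s\<in>S. \<Sum>t\<in>S. if t = s then c s * c s * h else 0)"
      by (intro sum.cong refl) (simp add: orth)
    then show ?thesis
      using S h by (simp add: c_def sum_divide_distrib power2_eq_square)
  qed
  also have "(\<Sum>s\<in>S. c s * (\<integral>x. g x * H s x \<partial>Q)) = (\<Sum>s\<in>S. (\<integral>x. g x * H s x \<partial>Q)\<^sup>2) / h"
    by (simp add: c_def sum_divide_distrib power2_eq_square)
  finally show "(\<Sum>s\<in>S. (\<integral>x. g x * H s x \<partial>Q)\<^sup>2) / h \<le> (\<integral>x. (g x)\<^sup>2 \<partial>Q)" by linarith
qed

section \<open>Comparison of the covariate law with the uniform law on the box\<close>

lemma box_law_eq_density:
  assumes M: "\<And>j. M j > 0"
  shows "box_law d M = density (Rd d) (\<lambda>x. ennreal (indicator (cov_box d M) x / (\<Prod>j=1..d. M j)))"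
proof -
  have sf: "sigma_finite_measure (density lborel (\<lambda>x. ennreal (indicator {- M j / 2..M j / 2} x / M j)))" for j
    using prob_space_imp_sigma_finite[OF prob_space_unif[OF M, of j]] by (simp add: unif_def)
  have "box_law d M = density (Rd d) (\<lambda>x. \<Prod>j=1..d. ennreal (indicator {- M j / 2..M j / 2} (x j) / M j))"
    unfolding box_law_def Rd_def unif_def
    by (rule PiM_density[OF _ _ _ sf]) (auto intro: lborel.sigma_finite_measure_axioms)
  also have "\<dots> = density (Rd d) (\<lambda>x. ennreal (indicator (cov_box d M) x / (\<Prod>j=1..d. M j)))"
  proof (rule density_cong)
    have [measurable]: "(\<lambda>x. x j) \<in> borel_measurable (Rd d)" if "j \<in> {1..d}" for j
      using measurable_component_singleton[of j "{1..d}" "\<lambda>_. lborel"] that by (simp add: Rd_def)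
    show "(\<lambda>x. \<Prod>j=1..d. ennreal (indicator {- M j / 2..M j / 2} (x j) / M j)) \<in> borel_measurable (Rd d)"
      by measurable
    have [measurable]: "cov_box d M \<in> sets (Rd d)"
      unfolding cov_box_def Rd_def by (intro sets_PiM_I_finite) auto
    show "(\<lambda>x. ennreal (indicator (cov_box d M) x / (\<Prod>j=1..d. M j))) \<in> borel_measurable (Rd d)"
      by measurable
    show "AE x in Rd d. (\<Prod>j=1..d. ennreal (indicator {- M j / 2..M j / 2} (x j) / M j))
        = ennreal (indicator (cov_box d M) x / (\<Prod>j=1..d. M j))"
    proof (rule AE_I2)
      fix x assume x: "x \<in> space (Rd d)"
      have "(\<Prod>j=1..d. ennreal (indicator {- M j / 2..M j / 2} (x j) / M j))
          = ennreal (\<Prod>j=1..d. indicator {- M j / 2..M j / 2} (x j) / M j)"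
        using M by (intro prod_ennreal) (auto intro!: divide_nonneg_pos)
      also have "(\<Prod>j=1..d. indicator {- M j / 2..M j / 2} (x j) / M j) = indicator (cov_box d M) x / (\<Prod>j=1..d. M j)"
      proof -
        have "(\<Prod>j=1..d. indicator {- M j / 2..M j / 2} (x j)) = (indicator (cov_box d M) x :: real)"
          using x by (auto simp: cov_box_def Rd_def space_PiM PiE_iff indicator_def prod_zero_iff)
        then show ?thesis by (simp add: prod_dividef)
      qed
      finally show "(\<Prod>j=1..d. ennreal (indicator {- M j / 2..M j / 2} (x j) / M j))
        = ennreal (indicator (cov_box d M) x / (\<Prod>j=1..d. M j))" .
    qed
  qed
  finally show ?thesis .
qed

lemma nn_integral_box_law:
  assumes M: "\<And>j. M j > 0" and F: "F \<in> borel_measurable (Rd d)"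
  shows "(\<integral>\<^sup>+x. F x \<partial>box_law d M) = (\<integral>\<^sup>+x. ennreal (indicator (cov_box d M) x / (\<Prod>j=1..d. M j)) * F x \<partial>Rd d)"
proof -
  have [measurable]: "cov_box d M \<in> sets (Rd d)"
    unfolding cov_box_def Rd_def by (intro sets_PiM_I_finite) auto
  show ?thesis
    unfolding box_law_eq_density[OF M] using F by (intro nn_integral_density) auto
qed

lemma prob_space_covariate_law: "prob_density d p0 \<Longrightarrow> prob_space (covariate_law d p0)"
  unfolding prob_density_def covariate_law_def
  by (intro prob_spaceI) (simp add: emeasure_density cong: nn_integral_cong)

lemma sets_covariate_law [simp, measurable_cong]: "sets (covariate_law d p0) = sets (Rd d)"
  by (simp add: covariate_law_def)

lemma space_covariate_law [simp]: "space (covariate_law d p0) = space (Rd d)"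
  by (simp add: covariate_law_def)

text \<open>\<open>B\<close> and \<open>b\<close> bound the density of the covariate law relative to
  the uniform law on the box. The upper bound keeps two hypotheses statistically close; the lower
  bound, in \<open>sq_norm_ge\<close>, turns an L2 distance into a loss.\<close>

lemma nn_integral_covariate_law_le:
  assumes M: "\<And>j. M j > 0" and p0: "prob_density d p0"
    and out: "\<And>x. x \<in> space (Rd d) \<Longrightarrow> x \<notin> cov_box d M \<Longrightarrow> p0 x = 0"
    and B: "\<And>x. x \<in> space (Rd d) \<Longrightarrow> p0 x \<le> B / (\<Prod>j=1..d. M j)" "B \<ge> 0"
    and F [measurable]: "F \<in> borel_measurable (Rd d)"
  shows "(\<integral>\<^sup>+x. F x \<partial>covariate_law d p0) \<le> ennreal B * (\<integral>\<^sup>+x. F x \<partial>box_law d M)"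
proof -
  have [measurable]: "cov_box d M \<in> sets (Rd d)"
    unfolding cov_box_def Rd_def by (intro sets_PiM_I_finite) auto
  have [measurable]: "p0 \<in> borel_measurable (Rd d)" using p0 by (simp add: prob_density_def)
  have "(\<integral>\<^sup>+x. F x \<partial>covariate_law d p0) = (\<integral>\<^sup>+x. ennreal (p0 x) * F x \<partial>Rd d)"
    unfolding covariate_law_def by (intro nn_integral_density) auto
  also have "\<dots> \<le> (\<integral>\<^sup>+x. ennreal B * (ennreal (indicator (cov_box d M) x / (\<Prod>j=1..d. M j)) * F x) \<partial>Rd d)"
  proof (rule nn_integral_mono)
    fix x assume x: "x \<in> space (Rd d)"
    have "p0 x \<le> B * (indicator (cov_box d M) x / (\<Prod>j=1..d. M j))"
      using B(1)[OF x] out[OF x] by (auto split: split_indicator)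
    then have "ennreal (p0 x) \<le> ennreal B * ennreal (indicator (cov_box d M) x / (\<Prod>j=1..d. M j))"
      using B(2) by (subst ennreal_mult'[symmetric]) (auto intro: ennreal_leI)
    then show "ennreal (p0 x) * F x \<le> ennreal B * (ennreal (indicator (cov_box d M) x / (\<Prod>j=1..d. M j)) * F x)"
      by (simp add: mult.assoc[symmetric] mult_right_mono)
  qed
  also have "\<dots> = ennreal B * (\<integral>\<^sup>+x. F x \<partial>box_law d M)"
    unfolding nn_integral_box_law[OF M F] by (rule nn_integral_cmult) measurable
  finally show ?thesis .
qed

lemma sq_norm_ge:
  assumes M: "\<And>j. M j > 0" and p0: "prob_density d p0"
    and b: "\<And>x. x \<in> cov_box d M \<Longrightarrow> b / (\<Prod>j=1..d. M j) \<le> p0 x" "b > 0"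
    and g [measurable]: "g \<in> borel_measurable (Rd d)"
  shows "ennreal b * (\<integral>\<^sup>+x. ennreal ((g x)\<^sup>2) \<partial>box_law d M) \<le> sq_norm d p0 g"
proof -
  have [measurable]: "cov_box d M \<in> sets (Rd d)"
    unfolding cov_box_def Rd_def by (intro sets_PiM_I_finite) auto
  have "ennreal b * (\<integral>\<^sup>+x. ennreal ((g x)\<^sup>2) \<partial>box_law d M)
      = (\<integral>\<^sup>+x. ennreal b * (ennreal (indicator (cov_box d M) x / (\<Prod>j=1..d. M j)) * ennreal ((g x)\<^sup>2)) \<partial>Rd d)"
    by (subst nn_integral_box_law[OF M]) (auto simp: nn_integral_cmult)
  also have "\<dots> \<le> sq_norm d p0 g"
    unfolding sq_norm_def
  proof (rule nn_integral_mono)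
    fix x assume x: "x \<in> space (Rd d)"
    have MM: "(\<Prod>j=1..d. M j) > 0" using M by (intro prod_pos) auto
    have "b * (indicator (cov_box d M) x / (\<Prod>j=1..d. M j)) \<le> p0 x"
      using b(1)[of x] p0 x by (auto simp: prob_density_def split: split_indicator)
    then have "b * (indicator (cov_box d M) x / (\<Prod>j=1..d. M j)) * (g x)\<^sup>2 \<le> p0 x * (g x)\<^sup>2"
      by (rule mult_right_mono) simp
    then show "ennreal b * (ennreal (indicator (cov_box d M) x / (\<Prod>j=1..d. M j)) * ennreal ((g x)\<^sup>2))
        \<le> ennreal ((g x)\<^sup>2 * p0 x)"
      using b(2) MM by (auto simp: ennreal_mult[symmetric] mult_ac intro: ennreal_leI split: split_indicator)
  qed
  finally show ?thesis .
qed

text \<open>If \<open>T\<close> is not square integrable then its Haar coefficients may be junk, but the right-hand side is infinite.\<close>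

lemma sq_norm_ge_coefficients:
  assumes M: "\<And>j. M j > 0" and p0: "prob_density d p0"
    and b: "\<And>x. x \<in> cov_box d M \<Longrightarrow> b / (\<Prod>j=1..d. M j) \<le> p0 x" "b > 0"
    and k: "k \<le> d" and S: "finite S" "S \<subseteq> dyadics k l"
    and T [measurable]: "T \<in> borel_measurable (Rd d)"
  shows "ennreal (b * 2 ^ l) * (\<Sum>s\<in>S. ennreal (((\<integral>x. T x * haars k M s x \<partial>box_law d M) - c s / (8 ^ k * 4 ^ l))\<^sup>2))
    \<le> sq_norm d p0 (\<lambda>x. T x - (\<Sum>s\<in>S. c s * bumps k M s x))"
proof -
  let ?Q = "box_law d M"
  interpret Q: prob_space ?Q by (rule prob_space_box_law[OF M])
  have meas_eq: "borel_measurable ?Q = borel_measurable (Rd d)"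
    by (rule measurable_cong_sets[OF sets_box_law refl])
  have [measurable]: "bumps k M s \<in> borel_measurable (Rd d)" "haars k M s \<in> borel_measurable (Rd d)" for s
    using measurable_bumps[OF M k] measurable_haars[OF M k] by auto
  define f where "f x = (\<Sum>s\<in>S. c s * bumps k M s x)" for x
  have f [measurable]: "f \<in> borel_measurable (Rd d)" unfolding f_def by measurable
  define g where "g x = T x - f x" for x
  have g [measurable]: "g \<in> borel_measurable (Rd d)" unfolding g_def by measurable
  have "ennreal (b * 2 ^ l) * (\<Sum>s\<in>S. ennreal (((\<integral>x. T x * haars k M s x \<partial>?Q) - c s / (8 ^ k * 4 ^ l))\<^sup>2))
    \<le> ennreal b * (\<integral>\<^sup>+x. ennreal ((g x)\<^sup>2) \<partial>?Q)"
  proof (cases "integrable ?Q (\<lambda>x. (g x)\<^sup>2)")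
    case False
    then have "(\<integral>\<^sup>+x. ennreal ((g x)\<^sup>2) \<partial>?Q) = \<infinity>"
      using g by (auto simp: integrable_iff_bounded meas_eq top.not_eq_extremum[symmetric])
    then show ?thesis using b(2) by (simp add: ennreal_mult_top)
  next
    case True
    have bounded: "integrable ?Q (\<lambda>x. F x * haars k M s x)" if "F \<in> borel_measurable (Rd d)" "\<And>x. \<bar>F x\<bar> \<le> 1" for F s
      using that by (intro Q.integrable_const_bound[where B = 1])
        (auto simp: abs_mult meas_eq intro!: mult_le_one abs_haars_le[OF M])
    note bessel = bessel_inequality[OF Q.prob_space_axioms S(1), of "1 / 2 ^ l" "haars k M" g]
    have hyp: "(1::real) / 2 ^ l > 0" "\<And>s. haars k M s \<in> borel_measurable ?Q" "\<And>s x. \<bar>haars k M s x\<bar> \<le> 1"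
      "\<And>s t. s \<in> S \<Longrightarrow> t \<in> S \<Longrightarrow> (\<integral>x. haars k M s x * haars k M t x \<partial>?Q) = (if s = t then 1 / 2 ^ l else 0)"
      "g \<in> borel_measurable ?Q"
      by (simp_all add: meas_eq abs_haars_le[OF M] integral_haars_haars[OF M k subsetD[OF S(2)] subsetD[OF S(2)]])
    have gh: "integrable ?Q (\<lambda>x. g x * haars k M s x)" if "s \<in> S" for s
      by (rule bessel(1)) (use hyp True that in auto)
    \<comment> \<open>Biorthogonality: of all terms in \<open>f\<close> only the one for
      \<open>s\<close> is seen by its Haar product.\<close>
    have fh: "integrable ?Q (\<lambda>x. f x * haars k M s x)"
      "(\<integral>x. f x * haars k M s x \<partial>?Q) = c s / (8 ^ k * 4 ^ l)" if s: "s \<in> S" for s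
    proof -
      have eq: "f x * haars k M s x = (\<Sum>t\<in>S. c t * (bumps k M t x * haars k M s x))" for x
        unfolding f_def sum_distrib_right by (simp only: mult.assoc)
      have I: "integrable ?Q (\<lambda>x. bumps k M t x * haars k M s x)" for t
        by (rule bounded) (auto intro: abs_bumps_le[OF M])
      show "integrable ?Q (\<lambda>x. f x * haars k M s x)"
        unfolding eq by (intro Bochner_Integration.integrable_sum integrable_mult_right I)
      have "(\<integral>x. f x * haars k M s x \<partial>?Q) = (\<Sum>t\<in>S. c t * (\<integral>x. bumps k M t x * haars k M s x \<partial>?Q))"
        unfolding eq using I by (simp add: Bochner_Integration.integral_sum)
      also have "\<dots> = (\<Sum>t\<in>S. if t = s then c s / (8 ^ k * 4 ^ l) else 0)"
        using S(2) s by (intro sum.cong refl) (subst integral_bumps_haars[OF M k], auto)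
      finally show "(\<integral>x. f x * haars k M s x \<partial>?Q) = c s / (8 ^ k * 4 ^ l)"
        using S(1) s by simp
    qed
    have coeff: "(\<integral>x. g x * haars k M s x \<partial>?Q) = (\<integral>x. T x * haars k M s x \<partial>?Q) - c s / (8 ^ k * 4 ^ l)"
      if s: "s \<in> S" for s
    proof -
      have "T x * haars k M s x = g x * haars k M s x + f x * haars k M s x" for x
        by (simp add: g_def algebra_simps)
      then show ?thesis
        using fh[OF s] gh[OF s] by simp
    qed
    have "(\<Sum>s\<in>S. (\<integral>x. g x * haars k M s x \<partial>?Q)\<^sup>2) / (1 / 2 ^ l) \<le> (\<integral>x. (g x)\<^sup>2 \<partial>?Q)"
      by (rule bessel(2)) (use hyp True in auto)
    then have "b * (2 ^ l * (\<Sum>s\<in>S. ((\<integral>x. T x * haars k M s x \<partial>?Q) - c s / (8 ^ k * 4 ^ l))\<^sup>2))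
        \<le> b * (\<integral>x. (g x)\<^sup>2 \<partial>?Q)"
      using b(2) coeff by (intro mult_left_mono) (auto simp: mult.commute)
    then have "ennreal (b * 2 ^ l * (\<Sum>s\<in>S. ((\<integral>x. T x * haars k M s x \<partial>?Q) - c s / (8 ^ k * 4 ^ l))\<^sup>2))
        \<le> ennreal (b * (\<integral>x. (g x)\<^sup>2 \<partial>?Q))"
      by (intro ennreal_leI) (simp add: mult_ac)
    also have "\<dots> = ennreal b * (\<integral>\<^sup>+x. ennreal ((g x)\<^sup>2) \<partial>?Q)"
      using True b(2) by (subst nn_integral_eq_integral) (auto simp: ennreal_mult')
    finally show ?thesis
      using b(2) by (simp add: sum_ennreal ennreal_mult' sum_nonneg)
  qed
  also have "\<dots> \<le> sq_norm d p0 g"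
    by (rule sq_norm_ge[OF M p0 b g])
  finally show ?thesis by (simp add: g_def[abs_def] f_def)
qed

section \<open>Averaging over all sign patterns\<close>

definition flip :: "'a \<Rightarrow> 'a set \<Rightarrow> 'a set" where
  "flip s A = (if s \<in> A then A - {s} else insert s A)"

text \<open>\<open>flip s\<close> is an involution of \<open>Pow S\<close>, so the sum of
  \<open>R A + R (flip s A)\<close> counts every term twice.\<close>

lemma sum_Pow_ge_of_flip:
  fixes R :: "'a set \<Rightarrow> ennreal"
  assumes S: "finite S" "s \<in> S" and c: "c \<ge> 0" and R: "\<And>A. A \<subseteq> S \<Longrightarrow> ennreal c \<le> R A + R (flip s A)"
  shows "2 ^ card S * ennreal (c / 2) \<le> (\<Sum>A\<in>Pow S. R A)"
proof -
  have "(\<Sum>A\<in>Pow S. R (flip s A)) = (\<Sum>A\<in>Pow S. R A)"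
    by (rule sum.reindex_bij_witness[where i = "flip s" and j = "flip s"]) (use S in \<open>auto simp: flip_def\<close>)
  then have eq: "(\<Sum>A\<in>Pow S. R A + R (flip s A)) = 2 * (\<Sum>A\<in>Pow S. R A)"
    by (simp add: sum.distrib mult_2)
  have "2 * (2 ^ card S * ennreal (c / 2)) = 2 ^ card S * (2 * ennreal (c / 2))"
    by (simp add: mult_ac)
  also have "2 * ennreal (c / 2) = ennreal c"
    using c by (simp add: ennreal_mult'[symmetric] flip: ennreal_numeral)
  also have "2 ^ card S * ennreal c = (\<Sum>A\<in>Pow S. ennreal c)"
    using S by (simp add: card_Pow)
  also have "\<dots> \<le> (\<Sum>A\<in>Pow S. R A + R (flip s A))"
    by (intro sum_mono R) auto
  finally have "2 * (2 ^ card S * ennreal (c / 2)) \<le> 2 * (\<Sum>A\<in>Pow S. R A)"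
    unfolding eq .
  then show ?thesis
    by (subst (asm) ennreal_mult_le_mult_iff) auto
qed

text \<open>The hypothesis on \<open>card S\<close> keeps every signed sum within the variation
  budget. The one on \<open>n\<close> makes a single flip undetectable: it moves the function by 2a
  times one product of bumps, at squared distance at most 4 a^2 B / 8^l. Each sign then costs, on
  average over all patterns, a quarter of its squared coefficient.\<close>

lemma minimax_risk_ge_assouad:
  assumes M: "\<And>j. M j > 0" and p0: "prob_density d p0"
    and out: "\<And>x. x \<in> space (Rd d) \<Longrightarrow> x \<notin> cov_box d M \<Longrightarrow> p0 x = 0"
    and B: "\<And>x. x \<in> space (Rd d) \<Longrightarrow> p0 x \<le> B / (\<Prod>j=1..d. M j)" "B \<ge> 0"
    and b: "\<And>x. x \<in> cov_box d M \<Longrightarrow> b / (\<Prod>j=1..d. M j) \<le> p0 x" "b > 0"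
    and k: "1 \<le> k" "k \<le> d" "k \<le> r" and S: "finite S" "S \<subseteq> dyadics k l"
    and V: "V > 0" and \<sigma>: "\<sigma> > 0"
    and a: "real (card S) * a\<^sup>2 / 2 ^ l \<le> V\<^sup>2" and close: "real n * a\<^sup>2 * B \<le> \<sigma>\<^sup>2 * 8 ^ l"
  shows "ennreal (b * 2 ^ l * real (card S) * (a / (8 ^ k * 4 ^ l))\<^sup>2 / 4) \<le> minimax_risk d r n V p0 \<sigma>"
  unfolding minimax_risk_def
proof (rule INF_greatest)
  fix T assume T: "T \<in> estimators d n"
  let ?Q = "box_law d M"
  let ?P = "covariate_law d p0"
  interpret Q: prob_space ?Q by (rule prob_space_box_law[OF M])
  interpret P: prob_space ?P by (rule prob_space_covariate_law[OF p0])
  have Tm [measurable]: "(\<lambda>(D, x). T D x) \<in> borel_measurable (data_space d n \<Otimes>\<^sub>M Rd d)"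
    using T by (simp add: estimators_def)
  have bumps_meas [measurable]: "bumps k M s \<in> borel_measurable (Rd d)" for s
    by (rule measurable_bumps[OF M k(2)])
  have [measurable]: "haars k M s \<in> borel_measurable (Rd d)" for s
    by (rule measurable_haars[OF M k(2)])
  \<comment> \<open>A subset \<open>A\<close> of \<open>S\<close> encodes the sign pattern that is
    +1 exactly on \<open>A\<close>.\<close>
  define \<epsilon> :: "dyadic set \<Rightarrow> dyadic \<Rightarrow> real" where "\<epsilon> A s = (if s \<in> A then 1 else - 1)" for A s
  define f where "f A x = (\<Sum>s\<in>S. (a * \<epsilon> A s) * bumps k M s x)" for A x
  define \<kappa> where "\<kappa> = a / (8 ^ k * 4 ^ l)"
  \<comment> \<open>The Haar coefficient of the estimate; its target under the pattern
    \<open>A\<close> is \<open>\<epsilon> A s * \<kappa>\<close>.\<close>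
  define W where "W s D = (\<integral>x. T D x * haars k M s x \<partial>?Q)" for s D
  define R where "R A s = (\<integral>\<^sup>+(X, \<xi>). ennreal ((W s (observed n (f A) X \<xi>) - \<epsilon> A s * \<kappa>)\<^sup>2) \<partial>sample_law d n p0 \<sigma>)" for A s
  have f_meas [measurable]: "f A \<in> borel_measurable (Rd d)" for A
    unfolding f_def by measurable
  \<comment> \<open>This is where the joint measurability demanded of estimators enters.\<close>
  have W_meas [measurable]: "W s \<in> borel_measurable (data_space d n)" for s
  proof -
    have "sets (data_space d n \<Otimes>\<^sub>M ?Q) = sets (data_space d n \<Otimes>\<^sub>M Rd d)"
      by (intro sets_pair_measure_cong sets_box_law refl)
    moreover have "(\<lambda>(D, x). T D x * haars k M s x) \<in> borel_measurable (data_space d n \<Otimes>\<^sub>M Rd d)"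
      by measurable
    ultimately have "(\<lambda>(D, x). T D x * haars k M s x) \<in> borel_measurable (data_space d n \<Otimes>\<^sub>M ?Q)"
      using measurable_cong_sets by blast
    then show ?thesis
      unfolding W_def by (rule Q.borel_measurable_lebesgue_integral)
  qed
  have obs_meas [measurable]: "(\<lambda>(X, \<xi>). observed n (f A) X \<xi>) \<in> measurable (sample_law d n p0 \<sigma>) (data_space d n)" for A
    unfolding observed_def sample_law_def data_space_def by measurable
  have in_class: "f A \<in> {f \<in> F_ST d r. V_XGB d r f \<le> ennreal V}" for A
  proof -
    have "(a * \<epsilon> A s)\<^sup>2 = a\<^sup>2" for s by (simp add: \<epsilon>_def)
    then have "(\<Sum>s\<in>S. (a * \<epsilon> A s)\<^sup>2) / 2 ^ l \<le> V\<^sup>2" using a by simp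
    from bump_sum_in_class[OF M k S V this] show ?thesis
      unfolding f_def[abs_def] by simp
  qed
  have risk: "ennreal (b * 2 ^ l) * (\<Sum>s\<in>S. R A s) \<le> risk d n p0 \<sigma> T (f A)" for A
  proof -
    have "ennreal (b * 2 ^ l) * (\<Sum>s\<in>S. R A s)
        = (\<integral>\<^sup>+z. ennreal (b * 2 ^ l) * (\<Sum>s\<in>S. ennreal ((W s (case z of (X, \<xi>) \<Rightarrow> observed n (f A) X \<xi>) - \<epsilon> A s * \<kappa>)\<^sup>2)) \<partial>sample_law d n p0 \<sigma>)"
    proof -
      have [measurable]: "(\<lambda>z. observed n (f A) (fst z) (snd z)) \<in> measurable (sample_law d n p0 \<sigma>) (data_space d n)"
        using obs_meas[of A] by (simp add: case_prod_beta')
      show ?thesis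
        unfolding R_def case_prod_beta'
        by (subst nn_integral_cmult, measurable) (subst nn_integral_sum, measurable)
    qed
    also have "\<dots> \<le> risk d n p0 \<sigma> T (f A)"
      unfolding risk_def
    proof (rule nn_integral_mono)
      fix z assume z: "z \<in> space (sample_law d n p0 \<sigma>)"
      define D where "D = (case z of (X, \<xi>) \<Rightarrow> observed n (f A) X \<xi>)"
      have "D \<in> space (data_space d n)"
        unfolding D_def using measurable_space[OF obs_meas z] .
      then have TD: "T D \<in> borel_measurable (Rd d)"
        using measurable_Pair2[OF Tm] by simp
      have "ennreal (b * 2 ^ l) * (\<Sum>s\<in>S. ennreal ((W s D - (a * \<epsilon> A s) / (8 ^ k * 4 ^ l))\<^sup>2))
          \<le> sq_norm d p0 (\<lambda>x. T D x - f A x)"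
        unfolding W_def f_def by (rule sq_norm_ge_coefficients[OF M p0 b k(2) S TD])
      then show "ennreal (b * 2 ^ l) * (\<Sum>s\<in>S. ennreal ((W s (case z of (X, \<xi>) \<Rightarrow> observed n (f A) X \<xi>) - \<epsilon> A s * \<kappa>)\<^sup>2))
          \<le> (case z of (X, \<xi>) \<Rightarrow> sq_norm d p0 (\<lambda>x. T (observed n (f A) X \<xi>) x - f A x))"
        unfolding D_def by (simp add: case_prod_beta' \<kappa>_def mult_ac)
    qed
    finally show ?thesis .
  qed
  have two_point: "ennreal (\<kappa>\<^sup>2 / 2) \<le> R (insert s A) s + R A s" if s: "s \<in> S" "s \<notin> A" for s A
  proof -
    have diff: "f (insert s A) x - f A x = 2 * a * bumps k M s x" for x
    proof -
      have "f (insert s A) x - f A x = (\<Sum>t\<in>S. if t = s then 2 * a * bumps k M s x else 0)"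
        unfolding f_def sum_subtractf[symmetric] using s by (intro sum.cong refl) (auto simp: \<epsilon>_def)
      then show ?thesis using S(1) s by simp
    qed
    have [measurable]: "bumps k M s \<in> borel_measurable ?Q"
      using bumps_meas[of s] measurable_cong_sets[OF sets_box_law refl] by blast
    have bsq: "integrable ?Q (\<lambda>x. (bumps k M s x)\<^sup>2)"
      by (rule Q.integrable_const_bound[where B = 1]) (auto simp: abs_square_le_1 abs_bumps_le[OF M])
    have "(\<integral>\<^sup>+x. ennreal ((f (insert s A) x - f A x)\<^sup>2) \<partial>?P)
        \<le> ennreal B * (\<integral>\<^sup>+x. ennreal ((f (insert s A) x - f A x)\<^sup>2) \<partial>?Q)"
      by (rule nn_integral_covariate_law_le[OF M p0 out B]) auto
    also have "(\<integral>\<^sup>+x. ennreal ((f (insert s A) x - f A x)\<^sup>2) \<partial>?Q) = ennreal (\<integral>x. (4 * a\<^sup>2) * (bumps k M s x)\<^sup>2 \<partial>?Q)"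
      unfolding diff using bsq by (subst nn_integral_eq_integral[symmetric]) (auto simp: power_mult_distrib)
    also have "\<dots> \<le> ennreal (4 * a\<^sup>2 * (1 / 8 ^ l))"
      using integral_bumps_sq_le[OF M k(2) subsetD[OF S(2) s(1)]]
      by (intro ennreal_leI) (simp only: integral_mult_right_zero, intro mult_left_mono, auto)
    finally have dist: "(\<integral>\<^sup>+x. ennreal ((f (insert s A) x - f A x)\<^sup>2) \<partial>?P) \<le> ennreal (B * (4 * a\<^sup>2 * (1 / 8 ^ l)))"
      using B(2) by (subst ennreal_mult) (auto simp: mult_left_mono)
    have "real n * (B * (4 * a\<^sup>2 * (1 / 8 ^ l))) \<le> 4 * \<sigma>\<^sup>2"
      using close by (simp add: field_simps)
    moreover have "0 \<le> B * (4 * a\<^sup>2 * (1 / 8 ^ l))" using B(2) by simp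
    moreover have "W s \<in> borel_measurable (PiM {1..n} (\<lambda>_. ?P \<Otimes>\<^sub>M lborel))"
    proof -
      have "sets (PiM {1..n} (\<lambda>_. ?P \<Otimes>\<^sub>M lborel)) = sets (data_space d n)"
        unfolding data_space_def by (intro sets_PiM_cong sets_pair_measure_cong) auto
      then show ?thesis using W_meas measurable_cong_sets by blast
    qed
    moreover have "f A' \<in> borel_measurable ?P" for A' by measurable
    ultimately have "ennreal (\<kappa>\<^sup>2 / 2)
        \<le> (\<integral>\<^sup>+(X, \<xi>). ennreal ((W s (observed n (f (insert s A)) X \<xi>) - \<kappa>)\<^sup>2) \<partial>sample_law d n p0 \<sigma>)
        + (\<integral>\<^sup>+(X, \<xi>). ennreal ((W s (observed n (f A) X \<xi>) + \<kappa>)\<^sup>2) \<partial>sample_law d n p0 \<sigma>)"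
      unfolding sample_law_def by (intro risk_two_point[OF P.prob_space_axioms \<sigma> _ _ _ dist])
    then show ?thesis
      using s by (simp add: R_def \<epsilon>_def)
  qed
  have pair: "ennreal (\<kappa>\<^sup>2 / 2) \<le> R A s + R (flip s A) s" if "s \<in> S" for s A
    using two_point[of s A] two_point[of s "A - {s}"] that
    by (cases "s \<in> A") (auto simp: flip_def insert_absorb add.commute)
  have coordinate: "2 ^ card S * ennreal (\<kappa>\<^sup>2 / 2 / 2) \<le> (\<Sum>A\<in>Pow S. R A s)" if "s \<in> S" for s
    by (rule sum_Pow_ge_of_flip[OF S(1) that, where R = "\<lambda>A. R A s"]) (simp, rule pair[OF that])
  have "2 ^ card S * ennreal (b * 2 ^ l * real (card S) * \<kappa>\<^sup>2 / 4)
      = ennreal (b * 2 ^ l) * (\<Sum>s\<in>S. 2 ^ card S * ennreal (\<kappa>\<^sup>2 / 2 / 2))"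
  proof -
    have "ennreal (b * 2 ^ l * real (card S) * \<kappa>\<^sup>2 / 4) = ennreal ((b * 2 ^ l) * (real (card S) * (\<kappa>\<^sup>2 / 2 / 2)))"
      by (simp add: mult_ac)
    also have "\<dots> = ennreal (b * 2 ^ l) * (ennreal (real (card S)) * ennreal (\<kappa>\<^sup>2 / 2 / 2))"
      using b(2) by (simp only: ennreal_mult zero_le_power zero_le_numeral mult_nonneg_nonneg less_imp_le
          of_nat_0_le_iff zero_le_power2 divide_nonneg_nonneg)
    finally show ?thesis
      by (simp only: sum_constant ennreal_of_nat_eq_real_of_nat mult_ac)
  qed
  also have "\<dots> \<le> ennreal (b * 2 ^ l) * (\<Sum>s\<in>S. \<Sum>A\<in>Pow S. R A s)"
    by (intro mult_left_mono sum_mono coordinate) simp_all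
  also have "\<dots> = (\<Sum>A\<in>Pow S. ennreal (b * 2 ^ l) * (\<Sum>s\<in>S. R A s))"
    by (subst sum.swap) (simp add: sum_distrib_left)
  \<comment> \<open>Every pattern lies in the class, so each summand is at most the supremum of the
    risk; cancelling \<open>2 ^ card S\<close> finishes the averaging.\<close>
  also have "\<dots> \<le> (\<Sum>A\<in>Pow S. SUP f\<in>{f \<in> F_ST d r. V_XGB d r f \<le> ennreal V}. risk d n p0 \<sigma> T f)"
    by (rule sum_mono) (rule order.trans[OF risk], rule SUP_upper, rule in_class)
  also have "\<dots> = 2 ^ card S * (SUP f\<in>{f \<in> F_ST d r. V_XGB d r f \<le> ennreal V}. risk d n p0 \<sigma> T f)"
    using S(1) by (simp add: card_Pow)
  finally show "ennreal (b * 2 ^ l * real (card S) * (a / (8 ^ k * 4 ^ l))\<^sup>2 / 4)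
      \<le> (SUP f\<in>{f \<in> F_ST d r. V_XGB d r f \<le> ennreal V}. risk d n p0 \<sigma> T f)"
    unfolding \<kappa>_def by (subst (asm) ennreal_mult_le_mult_iff) (auto simp: power_eq_top_ennreal)
qed

subsection \<open>Choice of the resolution\<close>

text \<open>The first k - 1 scales range freely over 0..q and the last one is chosen to make the
  total k q. The subtraction does not truncate, since the others sum to at most (k - 1) q. Only
  these shapes are kept: they are easy to count and already of the right order.\<close>

definition scales :: "nat \<Rightarrow> nat \<Rightarrow> (nat \<Rightarrow> nat) set" where
  "scales k q = (\<lambda>m. m(k := k * q - (\<Sum>j\<in>{1..<k}. m j))) ` PiE {1..<k} (\<lambda>_. {..q})"

lemma finite_scales: "finite (scales k q)"
  unfolding scales_def by (intro finite_imageI finite_PiE) auto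

lemma card_scales: "card (scales k q) = (q + 1) ^ (k - 1)"
proof -
  have "inj_on (\<lambda>m. m(k := k * q - (\<Sum>j\<in>{1..<k}. m j))) (PiE {1..<k} (\<lambda>_. {..q}))"
  proof (rule inj_onI)
    fix m m' :: "nat \<Rightarrow> nat"
    assume m: "m \<in> PiE {1..<k} (\<lambda>_. {..q})" "m' \<in> PiE {1..<k} (\<lambda>_. {..q})"
      and eq: "m(k := k * q - (\<Sum>j\<in>{1..<k}. m j)) = m'(k := k * q - (\<Sum>j\<in>{1..<k}. m' j))"
    show "m = m'"
    proof
      fix j
      show "m j = m' j"
      proof (cases "j = k")
        case True
        \<comment> \<open>The coordinate \<open>k\<close> lies outside \<open>{1..<k}\<close>, so
          extensional functions agree there.\<close>
        then show ?thesis using m by (auto simp: PiE_iff extensional_def)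
      next
        case False
        then show ?thesis using fun_cong[OF eq, of j] by simp
      qed
    qed
  qed
  then show ?thesis
    unfolding scales_def by (simp add: card_image card_PiE flip: Suc_eq_plus1)
qed

lemma scales_multi_index:
  assumes k: "1 \<le> k" and m: "m \<in> scales k q"
  shows "m \<in> extensional {1..k}" "(\<Sum>j=1..k. m j) = k * q"
proof -
  obtain m' where m': "m' \<in> PiE {1..<k} (\<lambda>_. {..q})" "m = m'(k := k * q - (\<Sum>j\<in>{1..<k}. m' j))"
    using m by (auto simp: scales_def)
  show "m \<in> extensional {1..k}"
    using m' k by (auto simp: PiE_iff extensional_def)
  have "(\<Sum>j\<in>{1..<k}. m' j) \<le> (\<Sum>j\<in>{1..<k}. q)"
    using m'(1) by (intro sum_mono) auto
  also have "\<dots> \<le> k * q" by simp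
  finally have le: "(\<Sum>j\<in>{1..<k}. m' j) \<le> k * q" .
  have "{1..k} = insert k {1..<k}" using k by auto
  then have "(\<Sum>j=1..k. m j) = m k + (\<Sum>j\<in>{1..<k}. m j)" by simp
  also have "(\<Sum>j\<in>{1..<k}. m j) = (\<Sum>j\<in>{1..<k}. m' j)"
    using m'(2) by (intro sum.cong) auto
  finally show "(\<Sum>j=1..k. m j) = k * q"
    using le m'(2) by simp
qed

text \<open>For each shape the boxes tile the unit cube, which gives 2^(k q) positions.\<close>

lemma dyadic_family:
  assumes k: "1 \<le> k"
  obtains S where "finite S" "S \<subseteq> dyadics k (k * q)" "card S = (q + 1) ^ (k - 1) * 2 ^ (k * q)"
proof
  define I where "I m = PiE {1..k} (\<lambda>j. {0..<2 ^ m j :: int})" for m :: "nat \<Rightarrow> nat"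
  let ?S = "Sigma (scales k q) I"
  have fin: "finite (I m)" for m unfolding I_def by (intro finite_PiE) auto
  show "finite ?S" by (intro finite_SigmaI finite_scales fin)
  show "?S \<subseteq> dyadics k (k * q)"
  proof (rule subsetI)
    fix s assume "s \<in> ?S"
    then obtain m i where "s = (m, i)" "m \<in> scales k q" "i \<in> I m" by auto
    then show "s \<in> dyadics k (k * q)"
      using scales_multi_index[OF k] by (simp add: dyadics_def I_def)
  qed
  have "card (I m) = 2 ^ (k * q)" if "m \<in> scales k q" for m
  proof -
    have "card (I m) = (\<Prod>j=1..k. 2 ^ m j)"
      unfolding I_def by (subst card_PiE) (auto simp: nat_power_eq)
    also have "\<dots> = 2 ^ (k * q)"
      by (simp add: power_sum[symmetric] scales_multi_index[OF k that])
    finally show ?thesis .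
  qed
  then show "card ?S = (q + 1) ^ (k - 1) * 2 ^ (k * q)"
    by (subst card_SigmaI) (auto simp: finite_scales fin card_scales)
qed

text \<open>The least \<open>q\<close> satisfying the first inequality, which is the closeness
  condition, overshoots it by a bounded factor only; this gives the second one. In its constant,
  16^k B is the overshoot and (4 k)^(k-1) comes from comparing q + 1 with ln Z.\<close>

lemma resolution_level:
  assumes k: "1 \<le> k" and Z: "Z \<ge> 2" and B: "B \<ge> 1"
  obtains q :: nat where "B * Z \<le> real ((q + 1) ^ (k - 1)) * 8 ^ (k * q)"
    and "Z powr (- 2 / 3) * ln Z powr (2 * (real k - 1) / 3) * 4 ^ (k * q)
      \<le> (real (4 * k) ^ (k - 1) * 16 ^ k * B) powr (2 / 3)"
proof -
  let ?R = "\<lambda>q. real ((q + 1) ^ (k - 1))"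
  let ?P = "\<lambda>q. B * Z \<le> ?R q * 8 ^ (k * q)"
  have "\<exists>q. ?P q"
  proof -
    obtain q :: nat where q: "B * Z < 8 ^ q"
      using real_arch_pow[of 8 "B * Z"] by auto
    have "(8::real) ^ q \<le> 8 ^ (k * q)" using k by (intro power_increasing) auto
    also have "\<dots> \<le> ?R q * 8 ^ (k * q)"
      by (simp add: mult_le_cancel_right1 one_le_power)
    finally show ?thesis using q by (intro exI[of _ q]) linarith
  qed
  define q where "q = (LEAST q. ?P q)"
  have Pq: "?P q" unfolding q_def by (rule LeastI_ex) fact
  have BZ: "2 \<le> B * Z" using mult_mono[of 1 B 2 Z] Z B by simp
  \<comment> \<open>At q = 0 the right side is 1, below B Z >= 2; hence \<open>q\<close> has a
    predecessor, where minimality can be used.\<close>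
  have "q \<noteq> 0" using Pq BZ by (intro notI) simp
  then obtain p where p: "q = Suc p" by (cases q) auto
  have "\<not> ?P p" using not_less_Least[of p ?P] p unfolding q_def by simp
  then have less: "?R p * 8 ^ (k * p) < B * Z" by simp
  \<comment> \<open>One step in \<open>q\<close> multiplies the power of 8 by 8^k and the number of
    shapes by at most 2^(k-1), because p + 2 <= 2 (p + 1).\<close>
  have R8: "?R q * 8 ^ (k * q) \<le> 16 ^ k * (B * Z)"
  proof -
    have "?R q \<le> (2 * (real p + 1)) ^ (k - 1)"
      using p by (simp add: power_mono)
    also have "\<dots> = 2 ^ (k - 1) * ?R p" by (simp only: power_mult_distrib of_nat_power of_nat_add of_nat_1)
    also have "\<dots> \<le> 2 ^ k * ?R p" by (intro mult_right_mono power_increasing) auto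
    finally have "?R q * 8 ^ (k * q) \<le> (2 ^ k * ?R p) * 8 ^ (k * q)" by (intro mult_right_mono) auto
    also have "\<dots> = 16 ^ k * (?R p * 8 ^ (k * p))"
      using power_mult_distrib[of 2 "8::real" k] by (simp add: p power_add mult_ac)
    also have "\<dots> \<le> 16 ^ k * (B * Z)" using less by (intro mult_left_mono) auto
    finally show ?thesis .
  qed
  \<comment> \<open>The number of shapes is only polynomial in \<open>q\<close>, so q + 1 is at
    least ln Z / (4 k) and the shapes pay for the full logarithmic power.\<close>
  have lnZ: "0 < ln Z" "ln Z \<le> real (4 * k) * (real q + 1)"
  proof -
    show "0 < ln Z" using Z by simp
    have "Z \<le> B * Z" using B Z by simp
    also have "\<dots> \<le> ?R q * 8 ^ (k * q)" by (rule Pq)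
    finally have "ln Z \<le> ln (?R q * 8 ^ (k * q))" using Z by (subst ln_le_cancel_iff) auto
    also have "\<dots> = real (k - 1) * ln (real q + 1) + real (k * q) * ln 8"
      by (simp add: ln_mult ln_realpow add.commute)
    also have "\<dots> \<le> real k * real q + real (k * q) * 3"
    proof (intro add_mono mult_mono)
      show "ln (real q + 1) \<le> real q" using ln_add_one_self_le_self[of "real q"] by (simp add: add.commute)
      have "ln (8::real) = 3 * ln 2" using ln_realpow[of 2 3] by simp
      then show "ln (8::real) \<le> 3" using ln_2_less_1 by simp
    qed auto
    also have "\<dots> = real (4 * k) * real q" by simp
    also have "\<dots> \<le> real (4 * k) * (real q + 1)" by (intro mult_left_mono) auto
    finally show "ln Z \<le> real (4 * k) * (real q + 1)" .
  qed
  \<comment> \<open>Everything is a power 2/3, since 4 = 8^(2/3), so it remains to bound the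
    base.\<close>
  have eq: "Z powr (- 2 / 3) * ln Z powr (2 * (real k - 1) / 3) * 4 ^ (k * q)
      = (ln Z ^ (k - 1) * 8 ^ (k * q) / Z) powr (2 / 3)"
  proof -
    have "(8::real) ^ (k * q) = 2 powr (3 * real (k * q))"
      by (simp add: powr_realpow[symmetric] powr_powr[symmetric])
    then have 8: "((8::real) ^ (k * q)) powr (2 / 3) = 4 ^ (k * q)"
      by (simp add: powr_powr) (simp add: powr_powr[symmetric] powr_realpow[symmetric])
    have "(ln Z ^ (k - 1)) powr (2 / 3) = ln Z powr (2 * (real k - 1) / 3)"
      using lnZ(1) k by (simp add: powr_realpow[symmetric] powr_powr of_nat_diff field_simps)
    then show ?thesis
      using lnZ(1) Z 8 by (simp add: powr_mult powr_divide powr_minus_divide)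
  qed
  show thesis
  proof (rule that[OF Pq])
    have "ln Z ^ (k - 1) * 8 ^ (k * q) / Z \<le> (real (4 * k) * (real q + 1)) ^ (k - 1) * 8 ^ (k * q) / Z"
      using lnZ Z by (intro divide_right_mono mult_right_mono power_mono) auto
    also have "\<dots> = real (4 * k) ^ (k - 1) * (?R q * 8 ^ (k * q)) / Z"
      by (simp only: power_mult_distrib of_nat_power of_nat_add of_nat_1 mult.assoc)
    also have "\<dots> \<le> real (4 * k) ^ (k - 1) * (16 ^ k * (B * Z)) / Z"
      using Z by (intro divide_right_mono mult_left_mono R8) auto
    also have "\<dots> = real (4 * k) ^ (k - 1) * 16 ^ k * B"
      using Z by simp
    finally show "Z powr (- 2 / 3) * ln Z powr (2 * (real k - 1) / 3) * 4 ^ (k * q)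
        \<le> (real (4 * k) ^ (k - 1) * 16 ^ k * B) powr (2 / 3)"
      unfolding eq using lnZ(1) Z by (intro powr_mono2) auto
  qed
qed

text \<open>\<open>Z\<close> is the signal-to-noise ratio and the sample size condition says Z >= 2,
  which keeps the logarithm positive. The 64^k in the constant is the square of the factor 8^k in
  the biorthogonality value.\<close>

lemma minimax_risk_lower_bound:
  assumes M: "\<And>j. M j > 0" and p0: "prob_density d p0"
    and out: "\<And>x. x \<in> space (Rd d) \<Longrightarrow> x \<notin> cov_box d M \<Longrightarrow> p0 x = 0"
    and B: "\<And>x. x \<in> space (Rd d) \<Longrightarrow> p0 x \<le> B / (\<Prod>j=1..d. M j)" "B \<ge> 0"
    and b: "\<And>x. x \<in> cov_box d M \<Longrightarrow> b / (\<Prod>j=1..d. M j) \<le> p0 x" "b > 0"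
    and k: "1 \<le> k" "k \<le> d" "k \<le> r"
    and V: "V > 0" and \<sigma>: "\<sigma> > 0" and n: "real n \<ge> 2 * (\<sigma>\<^sup>2 / V\<^sup>2)"
  shows "ennreal (b / (4 * 64 ^ k * (real (4 * k) ^ (k - 1) * 16 ^ k * B) powr (2 / 3))
      * (\<sigma>\<^sup>2 * V / real n) powr (2 / 3) * ln (real n * V\<^sup>2 / \<sigma>\<^sup>2) powr (2 * (real k - 1) / 3))
    \<le> minimax_risk d r n V p0 \<sigma>"
proof -
  define Z where "Z = real n * V\<^sup>2 / \<sigma>\<^sup>2"
  have Z: "Z \<ge> 2" using n V \<sigma> by (simp add: Z_def field_simps)
  \<comment> \<open>A probability density relative to a probability measure cannot stay below 1;
    here the total mass 1 is at most \<open>B\<close> times the mass of the uniform law.\<close>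
  have B1: "B \<ge> 1"
  proof -
    have "1 = (\<integral>\<^sup>+x. 1 \<partial>covariate_law d p0)"
      using prob_space.emeasure_space_1[OF prob_space_covariate_law[OF p0]] by simp
    also have "\<dots> \<le> ennreal B * (\<integral>\<^sup>+x. 1 \<partial>box_law d M)"
      by (rule nn_integral_covariate_law_le[OF M p0 out B]) auto
    also have "\<dots> = ennreal B"
      using prob_space.emeasure_space_1[OF prob_space_box_law[OF M]] by simp
    finally show ?thesis using B(2) ennreal_le_iff[of B 1] by simp
  qed
  obtain q where q: "B * Z \<le> real ((q + 1) ^ (k - 1)) * 8 ^ (k * q)"
    "Z powr (- 2 / 3) * ln Z powr (2 * (real k - 1) / 3) * 4 ^ (k * q)
      \<le> (real (4 * k) ^ (k - 1) * 16 ^ k * B) powr (2 / 3)"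
    using resolution_level[OF k(1) Z B1] .
  obtain S where S: "finite S" "S \<subseteq> dyadics k (k * q)" "card S = (q + 1) ^ (k - 1) * 2 ^ (k * q)"
    using dyadic_family[OF k(1)] .
  define R l where "R = real ((q + 1) ^ (k - 1))" and "l = k * q"
  \<comment> \<open>The largest amplitude the budget allows: the squared L2 norm of the density is
    then exactly V^2.\<close>
  define a where "a = V / sqrt R"
  define E where "E = (real (4 * k) ^ (k - 1) * 16 ^ k * B) powr (2 / 3)"
  have R: "R > 0" by (simp add: R_def)
  have E: "E > 0" using B1 k(1) by (simp add: E_def)
  have a2: "a\<^sup>2 = V\<^sup>2 / R" using R by (simp add: a_def power_divide)
  have cardS: "real (card S) = R * 2 ^ l" by (simp add: S(3) R_def l_def)
  have "0 < 2 * (\<sigma>\<^sup>2 / V\<^sup>2)" using V \<sigma> by simp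
  then have "real n > 0" using n by linarith
  have "b / (4 * 64 ^ k * E) * (\<sigma>\<^sup>2 * V / real n) powr (2 / 3) * ln Z powr (2 * (real k - 1) / 3)
      \<le> b * V\<^sup>2 / (4 * 64 ^ k * 4 ^ l)"
  proof -
    \<comment> \<open>In terms of \<open>Z\<close> the polynomial part of the rate is V^2
      Z^(-2/3).\<close>
    have "\<sigma>\<^sup>2 * V / real n = V ^ 3 / Z"
      using V \<sigma> \<open>real n > 0\<close> by (simp add: Z_def field_simps power2_eq_square power3_eq_cube)
    moreover have "(V powr 3) powr (2 / 3) = V powr 2"
      unfolding powr_powr by simp
    then have "(V ^ 3) powr (2 / 3) = V\<^sup>2"
      using V by simp
    ultimately have pw: "(\<sigma>\<^sup>2 * V / real n) powr (2 / 3) = V\<^sup>2 * Z powr (- 2 / 3)"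
      using V Z by (simp add: powr_divide powr_minus_divide)
    have "b / (4 * 64 ^ k * E) * (\<sigma>\<^sup>2 * V / real n) powr (2 / 3) * ln Z powr (2 * (real k - 1) / 3)
        = b * V\<^sup>2 / (4 * 64 ^ k * E * 4 ^ l) * (Z powr (- 2 / 3) * ln Z powr (2 * (real k - 1) / 3) * 4 ^ l)"
      unfolding pw by simp
    also have "\<dots> \<le> b * V\<^sup>2 / (4 * 64 ^ k * E * 4 ^ l) * E"
      using q(2) b(2) E by (intro mult_left_mono) (auto simp: E_def l_def)
    also have "\<dots> = b * V\<^sup>2 / (4 * 64 ^ k * 4 ^ l)"
      using E by simp
    finally show ?thesis .
  qed
  \<comment> \<open>The number of shapes cancels between \<open>card S\<close> and a^2.\<close>
  also have "b * V\<^sup>2 / (4 * 64 ^ k * 4 ^ l) = b * 2 ^ l * real (card S) * (a / (8 ^ k * 4 ^ l))\<^sup>2 / 4"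
  proof -
    define x :: real where "x = 2 ^ l"
    have x: "x > 0" by (simp add: x_def)
    have 4: "4 ^ l = x * x" using power_mult_distrib[of "2::real" 2 l] by (simp add: x_def)
    have "(8::real) ^ k * 8 ^ k = 64 ^ k" using power_mult_distrib[of "8::real" 8 k] by simp
    then have sq: "(8 ^ k * (x * x))\<^sup>2 = 64 ^ k * (x * x * (x * x))"
      unfolding power2_eq_square by (metis mult.assoc mult.left_commute)
    show ?thesis
      unfolding power_divide a2 cardS x_def[symmetric] 4 sq
      using R x by (simp add: divide_simps)
  qed
  finally have "ennreal (b / (4 * 64 ^ k * E) * (\<sigma>\<^sup>2 * V / real n) powr (2 / 3) * ln Z powr (2 * (real k - 1) / 3))
      \<le> ennreal (b * 2 ^ l * real (card S) * (a / (8 ^ k * 4 ^ l))\<^sup>2 / 4)"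
    by (rule ennreal_leI)
  also have "\<dots> \<le> minimax_risk d r n V p0 \<sigma>"
  proof (rule minimax_risk_ge_assouad[OF M p0 out B b k S(1) _ V \<sigma>])
    show "S \<subseteq> dyadics k l" using S(2) by (simp add: l_def)
    show "real (card S) * a\<^sup>2 / 2 ^ l \<le> V\<^sup>2" using R by (simp add: cardS a2)
    have "real n * a\<^sup>2 * B = \<sigma>\<^sup>2 * (B * Z) / R"
      using \<sigma> by (simp add: a2 Z_def)
    also have "\<dots> \<le> \<sigma>\<^sup>2 * (R * 8 ^ l) / R"
      using q(1) R by (intro divide_right_mono mult_left_mono) (auto simp: R_def l_def)
    also have "\<dots> = \<sigma>\<^sup>2 * 8 ^ l" using R by simp
    finally show "real n * a\<^sup>2 * B \<le> \<sigma>\<^sup>2 * 8 ^ l" .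
  qed
  finally show ?thesis unfolding E_def Z_def .
qed

theorem theorem5:
  shows "\<exists>(C\<^sub>1 :: real \<Rightarrow> real \<Rightarrow> nat \<Rightarrow> real) (C\<^sub>2 :: real \<Rightarrow> nat \<Rightarrow> real).
    (\<forall>b B k. C\<^sub>1 b B k > 0) \<and> (\<forall>B k. C\<^sub>2 B k > 0) \<and>
    (\<forall>(d::nat) (s::nat) (n::nat) (V::real) (\<sigma>::real) (M :: nat \<Rightarrow> real)
      (p0 :: (nat \<Rightarrow> real) \<Rightarrow> real) (b::real) (B::real).
        d \<ge> 1 \<longrightarrow> s \<ge> 1 \<longrightarrow> n \<ge> 1 \<longrightarrow> V > 0 \<longrightarrow> \<sigma> > 0 \<longrightarrow>
        prob_density d p0 \<longrightarrow>
        (\<forall>j\<in>{1..d}. M j > 0) \<longrightarrow>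
        (\<forall>x\<in>space (Rd d). x \<notin> cov_box d M \<longrightarrow> p0 x = 0) \<longrightarrow>
        bdd_above (p0 ` space (Rd d)) \<longrightarrow>
        B = (\<Prod>j=1..d. M j) * (SUP x\<in>space (Rd d). p0 x) \<longrightarrow>
        b = (\<Prod>j=1..d. M j) * (INF x\<in>cov_box d M. p0 x) \<longrightarrow>
        b > 0 \<longrightarrow>
        real n \<ge> C\<^sub>2 B (min s d) * (\<sigma>\<^sup>2 / V\<^sup>2) \<longrightarrow>
        minimax_risk d s n V p0 \<sigma> \<ge>
          ennreal (C\<^sub>1 b B (min s d) * (\<sigma>\<^sup>2 * V / real n) powr (2 / 3)
            * ln (real n * V\<^sup>2 / \<sigma>\<^sup>2) powr (2 * (real (min s d) - 1) / 3)))"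
proof -
  \<comment> \<open>The constants must be positive for all arguments, hence the value 1 outside the
    range that occurs.\<close>
  define C\<^sub>1 :: "real \<Rightarrow> real \<Rightarrow> nat \<Rightarrow> real" where
    "C\<^sub>1 b B k = (if b > 0 \<and> B > 0
      then b / (4 * 64 ^ k * (real (4 * k) ^ (k - 1) * 16 ^ k * B) powr (2 / 3)) else 1)" for b B k
  have C1_pos: "C\<^sub>1 b B k > 0" for b B k
    by (cases k) (auto simp: C\<^sub>1_def)
  have main: "minimax_risk d s n V p0 \<sigma> \<ge>
          ennreal (C\<^sub>1 b B (min s d) * (\<sigma>\<^sup>2 * V / real n) powr (2 / 3)
            * ln (real n * V\<^sup>2 / \<sigma>\<^sup>2) powr (2 * (real (min s d) - 1) / 3))"
    if ds: "d \<ge> 1" "s \<ge> 1" and V: "V > 0" and \<sigma>: "\<sigma> > 0" and p0: "prob_density d p0"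
      and M: "\<forall>j\<in>{1..d}. M j > 0" and out: "\<forall>x\<in>space (Rd d). x \<notin> cov_box d M \<longrightarrow> p0 x = 0"
      and bdd: "bdd_above (p0 ` space (Rd d))"
      and B: "B = (\<Prod>j=1..d. M j) * (SUP x\<in>space (Rd d). p0 x)"
      and b: "b = (\<Prod>j=1..d. M j) * (INF x\<in>cov_box d M. p0 x)" "b > 0"
      and n: "real n \<ge> 2 * (\<sigma>\<^sup>2 / V\<^sup>2)"
    for d s n :: nat and V \<sigma> b B :: real and M :: "nat \<Rightarrow> real" and p0 :: "(nat \<Rightarrow> real) \<Rightarrow> real"
  proof -
    \<comment> \<open>The product measure lemmas want a probability law at every index, so the side
      lengths are extended by 1 outside \<open>{1..d}\<close>; neither the box nor its volume
      changes.\<close>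
    define M' where "M' j = (if j \<in> {1..d} then M j else 1)" for j
    have M': "M' j > 0" for j using M by (simp add: M'_def)
    have prod: "(\<Prod>j=1..d. M' j) = (\<Prod>j=1..d. M j)" by (intro prod.cong) (auto simp: M'_def)
    have box: "cov_box d M' = cov_box d M" unfolding cov_box_def by (intro PiE_cong) (auto simp: M'_def)
    have pos: "(\<Prod>j=1..d. M j) > 0" using M by (intro prod_pos) auto
    have nonzero: "(\<Prod>j=1..d. M j) \<noteq> 0" by (rule less_imp_neq[OF pos, symmetric])
    have box_space: "cov_box d M \<subseteq> space (Rd d)"
      by (auto simp: cov_box_def Rd_def space_PiM PiE_iff)
    have p0_nonneg: "p0 x \<ge> 0" if "x \<in> space (Rd d)" for x
      using p0 that by (auto simp: prob_density_def)
    have upper: "p0 x \<le> B / (\<Prod>j=1..d. M j)" if "x \<in> space (Rd d)" for x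
      unfolding B nonzero_mult_div_cancel_left[OF nonzero] by (rule cSUP_upper[OF that bdd])
    have lower: "b / (\<Prod>j=1..d. M j) \<le> p0 x" if "x \<in> cov_box d M" for x
    proof -
      have "bdd_below (p0 ` cov_box d M)" using p0_nonneg box_space by (intro bdd_belowI2[of _ 0]) auto
      then show ?thesis
        unfolding b(1) nonzero_mult_div_cancel_left[OF nonzero] by (rule cINF_lower[OF _ that])
    qed
    \<comment> \<open>The centre of the box is a point where both bounds on the density hold, so b
      <= B; in particular \<open>B\<close> is positive and the first branch of
      \<open>C\<^sub>1\<close> applies.\<close>
    have "(\<lambda>j\<in>{1..d}. 0) \<in> cov_box d M"
      using M by (auto simp: cov_box_def less_imp_le)
    then have "b / (\<Prod>j=1..d. M j) \<le> B / (\<Prod>j=1..d. M j)"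
      using upper lower box_space by (meson order.trans subsetD)
    then have "b \<le> B" using pos by (simp add: divide_le_cancel)
    have "ennreal (b / (4 * 64 ^ (min s d) * (real (4 * (min s d)) ^ (min s d - 1) * 16 ^ (min s d) * B) powr (2 / 3))
        * (\<sigma>\<^sup>2 * V / real n) powr (2 / 3) * ln (real n * V\<^sup>2 / \<sigma>\<^sup>2) powr (2 * (real (min s d) - 1) / 3))
      \<le> minimax_risk d s n V p0 \<sigma>"
      by (rule minimax_risk_lower_bound[OF M' p0]) (use out upper lower box prod b(2) \<open>b \<le> B\<close> ds V \<sigma> n in auto)
    then show ?thesis using b(2) \<open>b \<le> B\<close> by (simp add: C\<^sub>1_def)
  qed
  show ?thesis
    by (rule exI[of _ C\<^sub>1], rule exI[of _ "\<lambda>_ _. 2"]) (use C1_pos main in auto)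
qed

end
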